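(* Let $\alpha>-1/2$, let $f_\alpha(\lambda)=(2\pi)^{-1}|1-e^{i\lambda}|^{2\alpha}$, and let $f(\lambda)=f_\alpha(\lambda)g(\lambda)$, $\lambda\in[-\pi,\pi]$, where $g$ has the form $g(\lambda)=h(\lambda)|\lambda-\lambda_1|^{\alpha(1)}\cdots|\lambda-\lambda_r|^{\alpha(r)}$ with $\lambda_j\in[-\pi,\pi]$, $\alpha(j)\ge0$, $h$ nonnegative, integrable, continuous at $0$ and with a positive lower bound; assume moreover that $g$ is slowly varying at $0$ and $g(0)>0$. Let $r_\alpha(k)=\int_{-\pi}^{\pi}e^{ik\lambda}f_\alpha(\lambda)d\lambda$ and $R_\alpha(k)=\int_{-\pi}^{\pi}e^{ik\lambda}f(\lambda)d\lambda$, and assume $R_\alpha(k)\sim r_\alpha(k)g(0)$ as $k\to\infty$. Consider $X(t)=m+Y(t)$, $t\in\mathbb{Z}$, with $Y$ a centered stationary process with spectral density $f$, and let $e(\infty,f,\bar X_n)=\lim_{n\to\infty}\mathrm{Var}_f(\widehat m_{BLU})/\mathrm{Var}_f(\bar X_n)$, where $\bar X_n$ is the sample mean and $\widehat m_{BLU}$ the BLUE of $m$ based on the same $n$ observations. Then: (i) if $\alpha\in(-1/2,1/2)\setminus\{0\}$, then $e(\infty,f,\bar X_n)=\dfrac{\pi\alpha(1-2\alpha)}{B(\alpha+1,\alpha+1)\sin\pi\alpha}$; (ii) if $\alpha\ge1/2$, then $e(\infty,f,\bar X_n)=0$.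
   Context: $B(\cdot,\cdot)$ is the Beta function. A function $L$ is slowly varying at $0$ if $L(xt)/L(x)\to1$ as $x\to0$ for every $t>0$. The BLUE $\widehat m_{BLU}$ is the linear unbiased estimator $\sum c_kX(k)$, $\sum c_k=1$, of minimal variance; for observations $X(0),\dots,X(n)$ its variance is $\min_{q}\int_{-\pi}^{\pi}|q(e^{i\lambda})|^2f(\lambda)d\lambda$ over complex polynomials $q$ of degree at most $n$ with $q(1)=1$. The efficiency $e(n,f,\bar X_n)$ is the ratio $\mathrm{Var}_f(\widehat m_{BLU})/\mathrm{Var}_f(\bar X_n)$. *)

theory Defs
  imports "HOL-Analysis.Analysis" "HOL-Library.Landau_Symbols"
begin

text \<open>Real power with the convention x^0 = 1 (Isabelle's powr has 0 powr 0 = 0).\<close>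
definition rpow0 :: "real \<Rightarrow> real \<Rightarrow> real" where
  "rpow0 x a = (if a = 0 then 1 else x powr a)"

definition f_alpha :: "real \<Rightarrow> real \<Rightarrow> real" where
  "f_alpha a x = rpow0 (cmod (1 - exp (\<i> * of_real x))) (2 * a) / (2 * pi)"

definition cov :: "(real \<Rightarrow> real) \<Rightarrow> nat \<Rightarrow> complex" where
  "cov f k = (LINT x:{-pi..pi}|lborel. exp (\<i> * of_nat k * of_real x) * of_real (f x))"

definition slowly_varying_at_0 :: "(real \<Rightarrow> real) \<Rightarrow> bool" where
  "slowly_varying_at_0 L \<longleftrightarrow> (\<forall>t>0. ((\<lambda>x. L (x * t) / L x) \<longlongrightarrow> 1) (at 0))"

text \<open>Variance of the BLUE of m based on observations X(0),...,X(n-1):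
  min over complex polynomials q of degree \<le> n-1 with q(1) = 1 of
  int_{-pi}^{pi} |q(e^{i lambda})|^2 f(lambda) d lambda.\<close>
definition var_blu :: "(real \<Rightarrow> real) \<Rightarrow> nat \<Rightarrow> real" where
  "var_blu f n = Inf {LINT x:{-pi..pi}|lborel.
        (cmod (\<Sum>k<n. c k * exp (\<i> * of_nat k * of_real x)))\<^sup>2 * f x
      | c :: nat \<Rightarrow> complex. (\<Sum>k<n. c k) = 1}"

definition var_mean :: "(real \<Rightarrow> real) \<Rightarrow> nat \<Rightarrow> real" where
  "var_mean f n = (LINT x:{-pi..pi}|lborel.
        (cmod (\<Sum>k<n. (1 / of_nat n) * exp (\<i> * of_nat k * of_real x)))\<^sup>2 * f x)"

definition efficiency :: "(real \<Rightarrow> real) \<Rightarrow> nat \<Rightarrow> real" where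
  "efficiency f n = var_blu f n / var_mean f n"

end

theory Submission
  imports Defs "HOL-Computational_Algebra.Polynomial" "HOL-Real_Asymp.Real_Asymp"
begin

text \<open>
  For the pure density \<open>f_alpha a\<close> everything is explicit. An integration by parts gives the
  autocovariances \<open>r\<close> the recurrence \<open>(m + 1 + a) r(m + 1) = (m - a) r(m)\<close>, from which the variance of
  the mean telescopes and the optimal weights are found to be proportional to
  \<open>u\<^sub>k u\<^sub>n\<^sub>-\<^sub>k\<close> with \<open>u\<^sub>k = (a + 1)\<^sub>k / k!\<close>. Both variances are multiples of \<open>r(0)\<close>,
  which therefore cancels in the efficiency.

  Passing from \<open>f_alpha a\<close> to \<open>f_alpha a * g\<close> multiplies both variances asymptotically by \<open>g 0\<close>. For the
  mean with \<open>a \<le> 1/2\<close> this holds because the Dirichlet kernel is bounded outside each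
  neighbourhood of 0 while the variances multiplied by \<open>n\<^sup>2\<close> diverge; for \<open>a > 1/2\<close> a lower bound of order \<open>n\<^sup>-\<^sup>2\<close>
  suffices. For the BLUE, multiply a competing polynomial by
  \<open>((1 + z) / 2)\<^sup>m\<close> with \<open>m\<close> about \<open>\<surd>n\<close>: this confines its mass to a neighbourhood of 0 up
  to a super-polynomially small error, at the price of an increase \<open>m = o(n)\<close> of the degree. For the
  lower bound one also multiplies by a fixed polynomial \<open>T\<close> whose zeros compensate those of \<open>g\<close>.
\<close>

section \<open>Optimal weights for the pure density and their normal equations\<close>

text \<open>The coefficients of the binomial series of
  \<open>(1 - z) powr (- (a + 1))\<close>.\<close>

definition blue_coeff :: "real \<Rightarrow> nat \<Rightarrow> real" where
  "blue_coeff a k = pochhammer (a + 1) k / fact k"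

lemma blue_coeff_0 [simp]: "blue_coeff a 0 = 1"
  by (simp add: blue_coeff_def)

lemma blue_coeff_Suc: "real (Suc k) * blue_coeff a (Suc k) = (real k + 1 + a) * blue_coeff a k"
  by (simp add: blue_coeff_def pochhammer_Suc field_simps del: of_nat_Suc)

lemma blue_coeff_pos: "a > -1 \<Longrightarrow> blue_coeff a k > 0"
  by (simp add: blue_coeff_def pochhammer_pos)

text \<open>Chu-Vandermonde: the square of the series \<open>(1 - z) powr (- (a + 1))\<close> is
  \<open>(1 - z) powr (- (2 * a + 2))\<close>. The value is the total by which the optimal weights
  are normalised.\<close>

lemma sum_blue_coeff:
  "(\<Sum>k\<le>n. blue_coeff a k * blue_coeff a (n - k)) = pochhammer (2 * a + 2) n / fact n"
proof -
  have eq: "blue_coeff a k = (-1) ^ k * ((- a - 1) gchoose k)" for k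
    by (simp add: blue_coeff_def gbinomial_pochhammer add.commute flip: power_mult_distrib)
  have "(\<Sum>k\<le>n. blue_coeff a k * blue_coeff a (n - k))
      = (\<Sum>k\<le>n. (-1) ^ n * (((- a - 1) gchoose k) * ((- a - 1) gchoose (n - k))))"
    by (intro sum.cong refl) (auto simp: eq simp flip: power_add)
  also have "\<dots> = (-1) ^ n * ((- 2 * a - 2) gchoose n)"
    using gbinomial_Vandermonde[of "- a - 1" "- a - 1" n] by (simp add: atMost_atLeast0 flip: sum_distrib_left)
  also have "\<dots> = pochhammer (2 * a + 2) n / fact n"
    by (simp add: gbinomial_pochhammer add.commute flip: power_mult_distrib)
  finally show ?thesis .
qed

text \<open>
  The sum \<open>F n j\<close> and its first moment \<open>M n j\<close> in \<open>k\<close> satisfy three linear relations, one for each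
  of the hypergeometric factors \<open>u\<^sub>n\<^sub>-\<^sub>k\<close>, \<open>u\<^sub>k\<close>, \<open>r(j - k)\<close>; evaluating \<open>F\<close> and
  \<open>M\<close> together makes an induction on \<open>n\<close> possible.
\<close>

lemma blue_normal_equations:
  fixes r :: "int \<Rightarrow> real"
  assumes a: "a > -1"
    and sym: "\<And>m. r (-m) = r m"
    and rec: "\<And>m. (of_int m + 1 + a) * r (m + 1) = (of_int m - a) * r m"
    and "j \<le> n"
  shows "(\<Sum>k\<le>n. r (int j - int k) * (blue_coeff a k * blue_coeff a (n - k))) = r 0"
proof -
  define t where "t n j k = r (int j - int k) * (blue_coeff a k * blue_coeff a (n - k))" for n j k :: nat
  define F where "F n j = (\<Sum>k\<le>n. t n j k)" for n j
  define M where "M n j = (\<Sum>k\<le>n. real k * t n j k)" for n j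
  \<comment> \<open>Weighting by \<open>Suc n - k\<close> kills the term \<open>k = Suc n\<close>
    and lowers the index of \<open>blue_coeff a (Suc n - k)\<close>, so \<open>n\<close> drops while
    \<open>j\<close> stays.\<close>
  have rel1: "real (Suc n) * F (Suc n) j - M (Suc n) j = (real n + 1 + a) * F n j - M n j" for n j
  proof -
    have "real (Suc n) * F (Suc n) j - M (Suc n) j = (\<Sum>k\<le>Suc n. real (Suc n - k) * t (Suc n) j k)"
      unfolding F_def M_def sum_distrib_left sum_subtractf[symmetric]
      by (intro sum.cong refl) (auto simp: of_nat_diff algebra_simps)
    also have "\<dots> = (\<Sum>k\<le>n. real (Suc n - k) * t (Suc n) j k)"
      by simp
    also have "\<dots> = (\<Sum>k\<le>n. (real n + 1 + a) * t n j k - real k * t n j k)"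
    proof (intro sum.cong refl)
      fix k assume "k \<in> {..n}"
      then have *: "Suc n - k = Suc (n - k)" "real (n - k) = real n - real k"
        by (auto simp: of_nat_diff)
      show "real (Suc n - k) * t (Suc n) j k = (real n + 1 + a) * t n j k - real k * t n j k"
        using blue_coeff_Suc[of "n - k" a] unfolding t_def * by algebra
    qed
    also have "\<dots> = (real n + 1 + a) * F n j - M n j"
      by (simp add: F_def M_def sum_distrib_left sum_subtractf)
    finally show ?thesis .
  qed
  \<comment> \<open>Weighting by \<open>k\<close> kills the term \<open>k = 0\<close>; shifting
    \<open>k\<close> together with \<open>j\<close> and \<open>n\<close> preserves the lag
    \<open>j - k\<close> and the index \<open>n - k\<close>.\<close>
  have rel2: "M (Suc n) (Suc j) = M n j + (1 + a) * F n j" for n j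
  proof -
    have "M (Suc n) (Suc j) = (\<Sum>k\<le>n. real (Suc k) * t (Suc n) (Suc j) (Suc k))"
      unfolding M_def by (subst sum.atMost_Suc_shift) simp
    also have "\<dots> = (\<Sum>k\<le>n. real k * t n j k + (1 + a) * t n j k)"
    proof (intro sum.cong refl)
      fix k
      have *: "int (Suc j) - int (Suc k) = int j - int k" "Suc n - Suc k = n - k"
        by auto
      show "real (Suc k) * t (Suc n) (Suc j) (Suc k) = real k * t n j k + (1 + a) * t n j k"
        using blue_coeff_Suc[of k a] unfolding t_def * by algebra
    qed
    also have "\<dots> = M n j + (1 + a) * F n j"
      by (simp add: F_def M_def sum_distrib_left sum.distrib)
    finally show ?thesis .
  qed
  have rel3: "(real j - a) * F n j - M n j = (real j + 1 + a) * F n (Suc j) - M n (Suc j)" for n j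
    unfolding F_def M_def sum_distrib_left sum_subtractf[symmetric]
  proof (intro sum.cong refl)
    fix k
    have *: "int (Suc j) - int k = (int j - int k) + 1" "real_of_int (int j - int k) = real j - real k"
      by auto
    show "(real j - a) * t n j k - real k * t n j k
        = (real j + 1 + a) * t n (Suc j) k - real k * t n (Suc j) k"
      using rec[of "int j - int k"] unfolding t_def * by algebra
  qed
  have t_rev: "t n (n - j) (n - k) = t n j k" if "j \<le> n" "k \<le> n" for n j k
  proof -
    have "int (n - j) - int (n - k) = - (int j - int k)"
      using that by auto
    then show ?thesis
      using that by (simp only: t_def sym) (simp add: mult_ac)
  qed
  have sum_rev: "(\<Sum>k\<le>n. f k) = (\<Sum>k\<le>n. f (n - k))" for f :: "nat \<Rightarrow> real" and n
    using sum.nat_diff_reindex[of f "Suc n"] by (simp add: lessThan_Suc_atMost)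
  have F_rev: "F n (n - j) = F n j" if "j \<le> n" for n j
    unfolding F_def by (subst sum_rev) (use that t_rev in \<open>auto intro!: sum.cong\<close>)
  have M_rev: "M n (n - j) = real n * F n j - M n j" if "j \<le> n" for n j
    unfolding F_def M_def sum_distrib_left sum_subtractf[symmetric]
    by (subst sum_rev) (use that t_rev in \<open>auto simp: of_nat_diff algebra_simps intro!: sum.cong\<close>)
  \<comment> \<open>In the induction step \<open>rel2\<close> yields \<open>M\<close> for
    \<open>j > 0\<close>, then \<open>rel1\<close> yields \<open>F\<close> at the interior indices,
    \<open>rel3\<close> leads on to \<open>j = Suc n\<close>, and the reflection
    \<open>k \<mapsto> n - k\<close> settles \<open>j = 0\<close>.\<close>
  have "\<forall>j\<le>n. F n j = r 0 \<and> M n j = r 0 * ((1 + 2 * a) * real j - a * real n)" for n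
  proof (induction n)
    case 0
    show ?case by (simp add: F_def M_def t_def)
  next
    case (Suc n)
    have M': "M (Suc n) j = r 0 * ((1 + 2 * a) * real j - a * real (Suc n))"
      if j: "0 < j" "j \<le> Suc n" for j
    proof -
      obtain i where "j = Suc i" using j(1) gr0_implies_Suc by blast
      with j have i: "j = Suc i" "i \<le> n" by auto
      have "F n i = r 0" "M n i = r 0 * ((1 + 2 * a) * real i - a * real n)"
        using Suc.IH i by auto
      then show ?thesis using rel2[of n i] unfolding i(1) by (simp add: algebra_simps)
    qed
    have F_mid: "F (Suc n) j = r 0" if "0 < j" "j \<le> n" for j
    proof -
      have "real (Suc n) * F (Suc n) j = real (Suc n) * r 0"
      proof -
        have "F n j = r 0" "M n j = r 0 * ((1 + 2 * a) * real j - a * real n)"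
          using Suc.IH that by auto
        moreover have "M (Suc n) j = r 0 * ((1 + 2 * a) * real j - a * real (Suc n))"
          using M' that by auto
        ultimately show ?thesis using rel1[of n j] by (simp add: algebra_simps)
      qed
      then show ?thesis by simp
    qed
    have F_top: "F (Suc n) (Suc n) = r 0"
    \<comment> \<open>For \<open>n = 0\<close> there is no interior index from which
      \<open>rel3\<close> could start.\<close>
    proof (cases "n = 0")
      case True
      have "r 1 * (1 + a) = - a * r 0" using rec[of 0] by (simp add: algebra_simps)
      then show ?thesis
        using True blue_coeff_Suc[of 0 a] by (simp add: F_def t_def distrib_left)
    next
      case False
      have "(real n + 1 + a) * F (Suc n) (Suc n) = (real n + 1 + a) * r 0"
      proof -
        have "F (Suc n) n = r 0" using F_mid False by auto
        moreover have "M (Suc n) n = r 0 * ((1 + 2 * a) * real n - a * real (Suc n))"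
          "M (Suc n) (Suc n) = r 0 * ((1 + 2 * a) * real (Suc n) - a * real (Suc n))"
          using M' False by auto
        ultimately show ?thesis using rel3[of n "Suc n"] by (simp add: algebra_simps)
      qed
      then show ?thesis using a by simp
    qed
    have F_bot: "F (Suc n) 0 = r 0"
      using F_rev[of "Suc n" "Suc n"] F_top by simp
    have M_bot: "M (Suc n) 0 = r 0 * ((1 + 2 * a) * real 0 - a * real (Suc n))"
    proof -
      have "M (Suc n) (Suc n) = r 0 * ((1 + 2 * a) * real (Suc n) - a * real (Suc n))"
        using M' by auto
      then show ?thesis
        using M_rev[of "Suc n" "Suc n"] F_top unfolding diff_self_eq_0 by (simp add: field_simps)
    qed
    show ?case
    proof (intro allI impI)
      fix j assume j: "j \<le> Suc n"
      consider "j = 0" | "0 < j" "j \<le> n" | "j = Suc n" using j by linarith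
      then show "F (Suc n) j = r 0 \<and> M (Suc n) j = r 0 * ((1 + 2 * a) * real j - a * real (Suc n))"
        by cases (use F_bot M_bot F_mid F_top M' j in auto)
    qed
  qed
  then show ?thesis using \<open>j \<le> n\<close> by (simp add: F_def t_def)
qed

section \<open>Autocovariances of the pure density\<close>

text \<open>An odd antiderivative of \<open>p \<bar>s\<bar>\<^bsup>p-1\<^esup>\<close>, so that one integration covers both sides of the singularity 0.\<close>

definition signed_powr :: "real \<Rightarrow> real \<Rightarrow> real" where
  "signed_powr p s = max s 0 powr p - max (- s) 0 powr p"

lemma continuous_on_signed_powr: "p > 0 \<Longrightarrow> continuous_on A (signed_powr p)"
  unfolding signed_powr_def[abs_def] by (intro continuous_intros continuous_on_powr') auto

lemma has_real_derivative_signed_powr: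
  assumes "s \<noteq> 0"
  shows "(signed_powr p has_real_derivative p * \<bar>s\<bar> powr (p - 1)) (at s)"
proof (cases "s > 0")
  case True
  have "((\<lambda>s. s powr p) has_real_derivative p * \<bar>s\<bar> powr (p - 1)) (at s)"
    using True by (auto intro!: derivative_eq_intros)
  then show ?thesis
    by (rule has_field_derivative_transform_within_open[of _ _ _ "{0<..}"])
      (use True in \<open>auto simp: signed_powr_def\<close>)
next
  case False
  then have "s < 0" using assms by simp
  have "((\<lambda>s. - ((- s) powr p)) has_real_derivative p * \<bar>s\<bar> powr (p - 1)) (at s)"
    using \<open>s < 0\<close> by (auto intro!: derivative_eq_intros)
  then show ?thesis
    by (rule has_field_derivative_transform_within_open[of _ _ _ "{..<0}"])
      (use \<open>s < 0\<close> in \<open>auto simp: signed_powr_def\<close>)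
qed

lemma sin_half_nonzero:
  assumes "x \<noteq> 0" "\<bar>x\<bar> \<le> pi"
  shows "sin (x / 2) \<noteq> 0"
  using assms sin_gt_zero[of "x / 2"] sin_gt_zero[of "- x / 2"] by (cases "x > 0") auto

lemma has_real_derivative_signed_powr_sin:
  assumes "x \<in> {-pi<..<pi} - {0}"
  shows "((\<lambda>x. signed_powr p (2 * sin (x / 2))) has_real_derivative
    p * \<bar>2 * sin (x / 2)\<bar> powr (p - 1) * cos (x / 2)) (at x)"
proof -
  have "sin (x / 2) \<noteq> 0"
    using assms by (intro sin_half_nonzero) auto
  moreover have "((\<lambda>x. 2 * sin (x / 2)) has_real_derivative cos (x / 2)) (at x)"
    by (auto intro!: derivative_eq_intros)
  ultimately show ?thesis
    by (intro DERIV_chain2[OF has_real_derivative_signed_powr]) simp_all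
qed

lemma f_alpha_eq:
  "a \<noteq> 0 \<Longrightarrow> f_alpha a x = \<bar>2 * sin (x / 2)\<bar> powr (2 * a) / (2 * pi)"
  using dist_exp_i_1[of x] by (simp add: f_alpha_def rpow0_def norm_minus_commute abs_mult)

lemma f_alpha_nonneg: "f_alpha a x \<ge> 0"
  by (simp add: f_alpha_def rpow0_def)

lemma f_alpha_minus: "f_alpha a (- x) = f_alpha a x"
  by (cases "a = 0") (simp add: f_alpha_def rpow0_def, simp add: f_alpha_eq)

lemma borel_measurable_f_alpha [measurable]: "f_alpha a \<in> borel_measurable borel"
  unfolding f_alpha_def[abs_def] rpow0_def by measurable

lemma set_integrable_mult_bounded:
  fixes f g :: "real \<Rightarrow> real"
  assumes "set_integrable lborel A f" and [measurable]: "g \<in> borel_measurable borel"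
    and "\<And>x. x \<in> A \<Longrightarrow> \<bar>g x\<bar> \<le> K"
  shows "set_integrable lborel A (\<lambda>x. g x * f x)"
proof -
  have "set_integrable lborel A (\<lambda>x. K * f x)"
    using assms(1) by simp
  then show ?thesis
    unfolding set_integrable_def
  proof (rule Bochner_Integration.integrable_bound)
    have [measurable]: "(\<lambda>x. indicator A x *\<^sub>R f x) \<in> borel_measurable lborel"
      using assms(1) unfolding set_integrable_def by blast
    have "(\<lambda>x. g x * (indicator A x *\<^sub>R f x)) \<in> borel_measurable lborel"
      by measurable
    then show "(\<lambda>x. indicator A x *\<^sub>R (g x * f x)) \<in> borel_measurable lborel"
      by (simp add: mult_ac)
    show "AE x in lborel. norm (indicator A x *\<^sub>R (g x * f x)) \<le> norm (indicator A x *\<^sub>R (K * f x))"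
      using assms(3) by (intro AE_I2) (force simp: indicator_def abs_mult intro!: mult_right_mono
        dest: assms(3))
  qed
qed

text \<open>The integrand is the derivative of \<open>G\<close> below, which is continuous across 0
  since \<open>2 * a + 1 > 0\<close> and vanishes at both ends because its cosine has half-integer
  frequency.\<close>

lemma has_integral_f_alpha_rec:
  fixes m :: int
  assumes "a > -1/2" "a \<noteq> 0"
  shows "((\<lambda>x. (of_int m + 1 + a) * (cos (of_int (m + 1) * x) * f_alpha a x)
      - (of_int m - a) * (cos (of_int m * x) * f_alpha a x)) has_integral 0) {-pi..pi}"
proof -
  define G where "G x = signed_powr (2 * a + 1) (2 * sin (x / 2)) * cos ((of_int m + 1/2) * x) / (2 * pi)" for x
  have G: "(G has_vector_derivative (of_int m + 1 + a) * (cos (of_int (m + 1) * x) * f_alpha a x)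
      - (of_int m - a) * (cos (of_int m * x) * f_alpha a x)) (at x)"
    if x: "x \<in> {-pi<..<pi} - {0}" for x
  proof -
    define s where "s = 2 * sin (x / 2)"
    define w where "w = \<bar>s\<bar> powr (2 * a)"
    have sp: "signed_powr (2 * a + 1) s = w * s"
      by (auto simp: w_def signed_powr_def powr_add max_def abs_if)
    have "(G has_real_derivative
        ((2 * a + 1) * w * cos (x / 2) * cos ((of_int m + 1/2) * x)
         - signed_powr (2 * a + 1) s * ((of_int m + 1/2) * sin ((of_int m + 1/2) * x))) / (2 * pi)) (at x)"
      unfolding G_def[abs_def]
      by (rule derivative_eq_intros has_real_derivative_signed_powr_sin x refl)+
         (simp_all add: w_def s_def field_simps)
    also have "(2 * a + 1) * w * cos (x / 2) * cos ((of_int m + 1/2) * x)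
         - signed_powr (2 * a + 1) s * ((of_int m + 1/2) * sin ((of_int m + 1/2) * x))
       = w * ((of_int m + 1 + a) * cos (of_int (m + 1) * x) - (of_int m - a) * cos (of_int m * x))"
    proof -
      \<comment> \<open>Both frequencies lie at distance 1/2 from \<open>m + 1/2\<close>, so the
        addition formulas express both cosines by the products that occur in the derivative.\<close>
      have 1: "of_int (m + 1) * x = (of_int m + 1/2) * x + x / 2"
        "of_int m * x = (of_int m + 1/2) * x - x / 2" by (auto simp: algebra_simps)
      show ?thesis
        unfolding sp unfolding 1 cos_add cos_diff s_def by (simp add: algebra_simps)
    qed
    also have "\<dots> / (2 * pi) = (of_int m + 1 + a) * (cos (of_int (m + 1) * x) * f_alpha a x)
      - (of_int m - a) * (cos (of_int m * x) * f_alpha a x)"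
      using assms by (simp add: f_alpha_eq w_def s_def field_simps)
    finally show ?thesis
      by (simp add: has_real_derivative_iff_has_vector_derivative)
  qed
  have "continuous_on {-pi..pi} G"
    unfolding G_def[abs_def]
    by (intro continuous_intros continuous_on_compose2[OF continuous_on_signed_powr[of _ UNIV]])
       (use assms in auto)
  then have "((\<lambda>x. (of_int m + 1 + a) * (cos (of_int (m + 1) * x) * f_alpha a x)
      - (of_int m - a) * (cos (of_int m * x) * f_alpha a x)) has_integral (G pi - G (-pi))) {-pi..pi}"
    by (intro fundamental_theorem_of_calculus_interior_strong[of "{0}"] G) auto
  moreover have "cos ((of_int m + 1/2) * pi) = 0"
    by (simp add: distrib_right cos_add mult.commute[of "of_int m" pi])
  then have "G pi = 0" "G (-pi) = 0"
    by (simp_all add: G_def)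
  ultimately show ?thesis by simp
qed

text \<open>With an extra factor \<open>cos (x / 2)\<close> the density has an explicit
  antiderivative. Where this cosine is at least 1/2 the factor is removed at the cost of a 2;
  elsewhere \<open>f_alpha a\<close> is bounded.\<close>

lemma set_integrable_f_alpha:
  assumes "a > -1/2" "a \<noteq> 0"
  shows "set_integrable lborel {-pi..pi} (f_alpha a)"
proof -
  define H where "H x = signed_powr (2 * a + 1) (2 * sin (x / 2)) / (2 * pi * (2 * a + 1))" for x
  have H: "(H has_vector_derivative cos (x / 2) * f_alpha a x) (at x)"
    if x: "x \<in> {-pi<..<pi} - {0}" for x
  proof -
    have "(H has_real_derivative (2 * a + 1) * \<bar>2 * sin (x / 2)\<bar> powr (2 * a + 1 - 1) * cos (x / 2) / (2 * pi * (2 * a + 1))) (at x)"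
      unfolding H_def[abs_def]
      by (intro DERIV_cdivide has_real_derivative_signed_powr_sin x)
    moreover have "(2 * a + 1) * \<bar>2 * sin (x / 2)\<bar> powr (2 * a + 1 - 1) * cos (x / 2) / (2 * pi * (2 * a + 1))
        = cos (x / 2) * f_alpha a x"
      using assms by (simp add: f_alpha_eq)
    ultimately show ?thesis
      by (simp add: has_real_derivative_iff_has_vector_derivative)
  qed
  have "continuous_on {-pi..pi} H"
    unfolding H_def[abs_def]
    by (intro continuous_intros continuous_on_compose2[OF continuous_on_signed_powr[of _ UNIV]])
       (use assms in auto)
  then have "(\<lambda>x. cos (x / 2) * f_alpha a x) integrable_on {-pi..pi}"
    by (intro has_integral_integrable[OF fundamental_theorem_of_calculus_interior_strong[of "{0}"]]) (auto intro: H)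
  then have "set_integrable lebesgue {-pi..pi} (\<lambda>x. cos (x / 2) * f_alpha a x)"
    by (intro nonnegative_absolutely_integrable_1)
       (auto intro!: mult_nonneg_nonneg cos_ge_zero f_alpha_nonneg)
  then have c: "set_integrable lborel {-pi..pi} (\<lambda>x. cos (x / 2) * f_alpha a x)"
    unfolding set_integrable_def by (subst (asm) integrable_completion) auto
  \<comment> \<open>\<open>C\<close> bounds the density where
    \<open>\<bar>2 * sin (x / 2)\<bar>\<close> lies between 1 and 2: the summand 1 serves negative
    \<open>a\<close>, the other one positive \<open>a\<close>.\<close>
  define C where "C = (1 + 2 powr (2 * a)) / (2 * pi)"
  have "set_integrable lborel {-pi..pi} (\<lambda>x. 2 * (cos (x / 2) * f_alpha a x) + C)"
    by (intro set_integral_add set_integrable_mult_right c) (auto simp: set_integrable_def)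
  then show ?thesis
  proof (rule set_integrable_bound)
    show "set_borel_measurable lborel {-pi..pi} (f_alpha a)"
      unfolding set_borel_measurable_def by measurable
    have "norm (f_alpha a x) \<le> norm (2 * (cos (x / 2) * f_alpha a x) + C)" if "x \<in> {-pi..pi}" for x
    proof -
      have c0: "cos (x / 2) \<ge> 0" using that by (intro cos_ge_zero) auto
      have C0: "C > 0" by (simp add: C_def add_pos_nonneg)
      have "f_alpha a x \<le> 2 * (cos (x / 2) * f_alpha a x) + C"
      proof (cases "cos (x / 2) \<ge> 1/2")
        case True
        then have "1/2 * f_alpha a x \<le> cos (x / 2) * f_alpha a x"
          by (intro mult_right_mono f_alpha_nonneg)
        then show ?thesis using C0 by linarith
      next
        case False
        then have "(cos (x / 2))\<^sup>2 \<le> (1/2)\<^sup>2" using c0 by (intro power_mono) auto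
        then have "1\<^sup>2 \<le> \<bar>2 * sin (x / 2)\<bar>\<^sup>2"
          using sin_cos_squared_add[of "x / 2"] by (simp add: power2_eq_square)
        then have 1: "1 \<le> \<bar>2 * sin (x / 2)\<bar>" by (rule power2_le_imp_le) simp
        have "\<bar>2 * sin (x / 2)\<bar> powr (2 * a) \<le> 1 + 2 powr (2 * a)"
        proof (cases "a \<ge> 0")
          case True
          then have "\<bar>2 * sin (x / 2)\<bar> powr (2 * a) \<le> 2 powr (2 * a)"
            by (intro powr_mono2) (auto simp: abs_mult)
          then show ?thesis by simp
        next
          case False
          then have "\<bar>2 * sin (x / 2)\<bar> powr (2 * a) \<le> \<bar>2 * sin (x / 2)\<bar> powr 0"
            using 1 by (intro powr_mono) auto
          also have "\<dots> = 1" using 1 by auto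
          finally show ?thesis by (simp add: add_increasing2)
        qed
        then have "f_alpha a x \<le> C"
          using assms by (simp add: f_alpha_eq C_def divide_right_mono)
        then show ?thesis using c0 f_alpha_nonneg[of a x] by (simp add: add_increasing)
      qed
      then show ?thesis
        using c0 C0 f_alpha_nonneg[of a x] by simp
    qed
    then show "AE x in lborel. x \<in> {-pi..pi} \<longrightarrow>
        norm (f_alpha a x) \<le> norm (2 * (cos (x / 2) * f_alpha a x) + C)"
      by (intro AE_I2) auto
  qed
qed

text \<open>The covariance as a real cosine transform: evenness of the density removes the sine
  part. Integer lags admit differences \<open>j - k\<close> of either sign.\<close>

definition acf :: "real \<Rightarrow> int \<Rightarrow> real" where
  "acf a m = (LINT x:{-pi..pi}|lborel. cos (of_int m * x) * f_alpha a x)"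

lemma set_integrable_cos_f_alpha:
  "a > -1/2 \<Longrightarrow> a \<noteq> 0 \<Longrightarrow> set_integrable lborel {-pi..pi} (\<lambda>x. cos (b * x) * f_alpha a x)"
  by (rule set_integrable_mult_bounded[OF set_integrable_f_alpha, where K = 1]) auto

lemma set_integrable_sin_f_alpha:
  "a > -1/2 \<Longrightarrow> a \<noteq> 0 \<Longrightarrow> set_integrable lborel {-pi..pi} (\<lambda>x. sin (b * x) * f_alpha a x)"
  by (rule set_integrable_mult_bounded[OF set_integrable_f_alpha, where K = 1]) auto

lemma acf_minus: "acf a (- m) = acf a m"
  by (simp add: acf_def)

lemma acf_rec:
  assumes "a > -1/2" "a \<noteq> 0"
  shows "(of_int m + 1 + a) * acf a (m + 1) = (of_int m - a) * acf a m"
proof -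
  let ?F = "\<lambda>x. (of_int m + 1 + a) * (cos (of_int (m + 1) * x) * f_alpha a x)
      - (of_int m - a) * (cos (of_int m * x) * f_alpha a x)"
  have i: "set_integrable lborel {-pi..pi} (\<lambda>x. c * (cos (b * x) * f_alpha a x))" for b c
    by (intro set_integrable_mult_right set_integrable_cos_f_alpha assms)
  have "(LINT x:{-pi..pi}|lborel. ?F x) = integral {-pi..pi} ?F"
    by (intro set_borel_integral_eq_integral set_integral_diff i)
  also have "\<dots> = 0"
    using has_integral_f_alpha_rec[OF assms, of m] by (rule integral_unique)
  finally show ?thesis
    by (subst (asm) set_integral_diff(2)[OF i i]) (simp add: acf_def)
qed

lemma set_integral_sin_f_alpha: "(LINT x:{-pi..pi}|lborel. sin (b * x) * f_alpha a x) = 0"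
proof -
  have "(LINT x:{-pi..pi}|lborel. sin (b * x) * f_alpha a x)
      = (LINT x:{-pi..pi}|lborel. - (sin (b * x) * f_alpha a x))"
    by (subst set_integral_reflect) (simp add: f_alpha_minus minus_le_iff conj_commute
        atLeastAtMost_def atLeast_def atMost_def Int_def)
  then show ?thesis by (simp add: set_lebesgue_integral_def)
qed

lemma acf_0_pos:
  assumes "a > -1/2" "a \<noteq> 0"
  shows "acf a 0 > 0"
proof -
  have "acf a 0 \<ge> 0"
    unfolding acf_def set_lebesgue_integral_def by (intro Bochner_Integration.integral_nonneg) (simp add: f_alpha_nonneg)
  moreover have "acf a 0 \<noteq> 0"
  proof
    assume "acf a 0 = 0"
    then have "AE x in lborel. indicator {-pi..pi} x *\<^sub>R f_alpha a x = 0"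
      using set_integrable_f_alpha[OF assms] unfolding acf_def set_lebesgue_integral_def set_integrable_def
      by (subst (asm) integral_nonneg_eq_0_iff_AE) (auto simp: f_alpha_nonneg)
    then have "AE x in lborel. x \<notin> {0<..<pi}"
    proof (eventually_elim, intro notI)
      fix x assume *: "indicator {-pi..pi} x *\<^sub>R f_alpha a x = 0" "x \<in> {0<..<pi}"
      have "sin (x / 2) > 0" using * by (intro sin_gt_zero) auto
      then show False using * assms by (simp add: f_alpha_eq indicator_def split: if_splits)
    qed
    then have "emeasure lborel {0<..<pi} = 0"
      by (subst (asm) AE_iff_measurable[of "{0<..<pi}"]) auto
    then show False by simp
  qed
  ultimately show ?thesis by simp
qed

section \<open>The best linear unbiased estimator\<close>

lemma exp_eq_cis_power: "exp (\<i> * of_nat k * of_real x) = cis x ^ k"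
  by (simp add: cis_conv_exp mult_ac flip: exp_of_nat_mult)

text \<open>The variance, under spectral density \<open>f\<close>, of the linear estimator whose
  weights are the coefficients of \<open>P\<close>; unbiasedness is
  \<open>poly P 1 = 1\<close>.\<close>

definition risk :: "(real \<Rightarrow> real) \<Rightarrow> complex poly \<Rightarrow> real" where
  "risk f P = (LINT x:{-pi..pi}|lborel. (cmod (poly P (cis x)))\<^sup>2 * f x)"

lemma cmod_poly_cis_le: "cmod (poly P (cis x)) \<le> (\<Sum>k\<le>degree P. cmod (coeff P k))"
  unfolding poly_altdef by (rule order_trans[OF norm_sum]) (simp add: norm_mult norm_power)

lemma borel_measurable_poly_cis [measurable]:
  "(\<lambda>x. poly P (cis x)) \<in> borel_measurable borel"
  by (intro borel_measurable_continuous_onI continuous_intros)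

lemma set_integrable_risk:
  "set_integrable lborel {-pi..pi} f \<Longrightarrow>
    set_integrable lborel {-pi..pi} (\<lambda>x. (cmod (poly P (cis x)))\<^sup>2 * f x)"
  by (rule set_integrable_mult_bounded[where K = "(\<Sum>k\<le>degree P. cmod (coeff P k))\<^sup>2"])
     (auto intro!: power_mono cmod_poly_cis_le)

lemma risk_nonneg: "(\<And>x. x \<in> {-pi..pi} \<Longrightarrow> f x \<ge> 0) \<Longrightarrow> risk f P \<ge> 0"
  unfolding risk_def set_lebesgue_integral_def
  by (intro Bochner_Integration.integral_nonneg) (auto simp: indicator_def)

lemma var_blu_eq_Inf_risk:
  "var_blu f (Suc n) = Inf {risk f P | P. degree P \<le> n \<and> poly P 1 = 1}"
proof -
  have "{LINT x:{-pi..pi}|lborel.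
        (cmod (\<Sum>k<Suc n. c k * exp (\<i> * of_nat k * of_real x)))\<^sup>2 * f x
      | c :: nat \<Rightarrow> complex. (\<Sum>k<Suc n. c k) = 1} = {risk f P | P. degree P \<le> n \<and> poly P 1 = 1}"
    (is "?A = ?B")
  proof (intro equalityI subsetI)
    fix y assume "y \<in> ?A"
    then obtain c :: "nat \<Rightarrow> complex" where c: "(\<Sum>k<Suc n. c k) = 1"
      and y: "y = (LINT x:{-pi..pi}|lborel. (cmod (\<Sum>k<Suc n. c k * exp (\<i> * of_nat k * of_real x)))\<^sup>2 * f x)"
      by blast
    define P where "P = (\<Sum>k\<le>n. monom (c k) k)"
    have P: "poly P z = (\<Sum>k<Suc n. c k * z ^ k)" for z
      by (simp add: P_def poly_sum poly_monom lessThan_Suc_atMost)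
    have "degree P \<le> n"
      unfolding P_def by (intro degree_sum_le) (auto intro: order_trans[OF degree_monom_le])
    moreover have "poly P 1 = 1" using c by (simp add: P)
    moreover have "y = risk f P" by (simp add: y risk_def P exp_eq_cis_power)
    ultimately show "y \<in> ?B" by blast
  next
    fix y assume "y \<in> ?B"
    then obtain P where P: "degree P \<le> n" "poly P 1 = 1" "y = risk f P" by blast
    have eq: "poly P z = (\<Sum>k<Suc n. coeff P k * z ^ k)" for z
      by (subst poly_as_sum_of_monoms'[OF P(1), symmetric])
         (simp add: poly_sum poly_monom lessThan_Suc_atMost)
    have "(\<Sum>k<Suc n. coeff P k) = 1" using eq[of 1] P(2) by simp
    moreover have "y = (LINT x:{-pi..pi}|lborel. (cmod (\<Sum>k<Suc n. coeff P k * exp (\<i> * of_nat k * of_real x)))\<^sup>2 * f x)"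
      by (simp only: P(3) risk_def eq exp_eq_cis_power)
    ultimately show "y \<in> ?A" by blast
  qed
  then show ?thesis by (simp only: var_blu_def)
qed

lemma var_blu_le_risk:
  assumes "\<And>x. x \<in> {-pi..pi} \<Longrightarrow> f x \<ge> 0" "degree P \<le> n" "poly P 1 = 1"
  shows "var_blu f (Suc n) \<le> risk f P"
  unfolding var_blu_eq_Inf_risk
proof (rule cInf_lower)
  show "bdd_below {risk f P |P. degree P \<le> n \<and> poly P 1 = 1}"
    by (intro bdd_belowI[of _ 0]) (auto intro: risk_nonneg assms(1))
qed (use assms in blast)

lemma le_var_blu:
  assumes "\<And>P. degree P \<le> n \<Longrightarrow> poly P 1 = 1 \<Longrightarrow> b \<le> risk f P"
  shows "b \<le> var_blu f (Suc n)"
proof -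
  \<comment> \<open>The constant polynomial shows that the set is nonempty, as a lower bound for its
    \<open>Inf\<close> requires.\<close>
  have "risk f 1 \<in> {risk f P | P. degree P \<le> n \<and> poly P 1 = 1}"
    by (rule CollectI, rule exI[of _ 1]) simp
  then show ?thesis
    unfolding var_blu_eq_Inf_risk by (intro cInf_greatest) (use assms in blast)+
qed

text \<open>Expanding the product gives the frequencies \<open>j - k\<close>; the sine terms
  integrate to 0, and since \<open>b\<close> is real the imaginary parts of \<open>d\<close>
  disappear with them. With the optimal weights as \<open>b\<close> the inner sums are
  constant.\<close>

lemma integral_Re_poly_mult_cnj:
  fixes d :: "nat \<Rightarrow> complex" and b :: "nat \<Rightarrow> real"
  assumes "a > -1/2" "a \<noteq> 0"
  shows "set_integrable lborel {-pi..pi}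
      (\<lambda>x. Re ((\<Sum>j\<le>n. d j * cis x ^ j) * cnj (\<Sum>k\<le>n. of_real (b k) * cis x ^ k)) * f_alpha a x)" (is ?int)
    and "(LINT x:{-pi..pi}|lborel.
      Re ((\<Sum>j\<le>n. d j * cis x ^ j) * cnj (\<Sum>k\<le>n. of_real (b k) * cis x ^ k)) * f_alpha a x)
     = (\<Sum>j\<le>n. Re (d j) * (\<Sum>k\<le>n. acf a (int j - int k) * b k))" (is ?eq)
proof -
  define T where "T j k x = Re (d j) * b k * (cos (of_int (int j - int k) * x) * f_alpha a x)
      - Im (d j) * b k * (sin (of_int (int j - int k) * x) * f_alpha a x)" for j k x
  have i: "set_integrable lborel {-pi..pi} (\<lambda>x. c * (cos (b * x) * f_alpha a x))"
    "set_integrable lborel {-pi..pi} (\<lambda>x. c * (sin (b * x) * f_alpha a x))" for b c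
    by (intro set_integrable_mult_right set_integrable_cos_f_alpha set_integrable_sin_f_alpha assms)+
  have iT: "set_integrable lborel {-pi..pi} (T j k)" for j k
    unfolding T_def by (intro set_integral_diff(1) i)
  have T: "(LINT x:{-pi..pi}|lborel. T j k x) = Re (d j) * b k * acf a (int j - int k)" for j k
    unfolding T_def
    by (subst set_integral_diff(2)[OF i(1) i(2)]) (simp add: acf_def set_integral_sin_f_alpha)
  have eq: "Re ((\<Sum>j\<le>n. d j * cis x ^ j) * cnj (\<Sum>k\<le>n. of_real (b k) * cis x ^ k)) * f_alpha a x
      = (\<Sum>j\<le>n. \<Sum>k\<le>n. T j k x)" for x
  proof -
    have *: "Re (d j * cis x ^ j * cnj (of_real (b k) * cis x ^ k)) * f_alpha a x = T j k x" for j k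
    proof -
      have "cis x ^ j * cnj (cis x ^ k) = cis (of_int (int j - int k) * x)"
        by (simp add: Complex.DeMoivre cis_cnj cis_mult algebra_simps)
      then have "d j * cis x ^ j * cnj (of_real (b k) * cis x ^ k)
          = of_real (b k) * (d j * cis (of_int (int j - int k) * x))"
        by (simp add: mult_ac)
      then show ?thesis
        by (simp only: T_def) (simp add: algebra_simps)
    qed
    show ?thesis
      unfolding cnj_sum sum_product unfolding Re_sum sum_distrib_right * ..
  qed
  have iS: "set_integrable lborel {-pi..pi} (\<lambda>x. \<Sum>j\<le>n. \<Sum>k\<le>n. T j k x)"
    unfolding set_integrable_def scaleR_sum_right
    by (intro Bochner_Integration.integrable_sum iT[unfolded set_integrable_def])
  then show ?int by (simp only: eq)
  have "(LINT x:{-pi..pi}|lborel. \<Sum>j\<le>n. \<Sum>k\<le>n. T j k x)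
      = (\<Sum>j\<le>n. \<Sum>k\<le>n. LINT x:{-pi..pi}|lborel. T j k x)"
    unfolding set_lebesgue_integral_def scaleR_sum_right
    by (simp only: Bochner_Integration.integral_sum Bochner_Integration.integrable_sum
        iT[unfolded set_integrable_def])
  then show ?eq unfolding eq T sum_distrib_left by (simp add: mult_ac)
qed

definition blue_norm :: "real \<Rightarrow> nat \<Rightarrow> real" where
  "blue_norm a n = pochhammer (2 * a + 2) n / fact n"

lemma blue_norm_pos: "a > -1/2 \<Longrightarrow> blue_norm a n > 0"
  by (simp add: blue_norm_def pochhammer_pos)

definition blue_weight :: "real \<Rightarrow> nat \<Rightarrow> nat \<Rightarrow> real" where
  "blue_weight a n k = blue_coeff a k * blue_coeff a (n - k) / blue_norm a n"

definition blue_poly :: "real \<Rightarrow> nat \<Rightarrow> complex poly" where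
  "blue_poly a n = (\<Sum>k\<le>n. monom (of_real (blue_weight a n k)) k)"

lemma blue_weight_nonneg: "a > -1/2 \<Longrightarrow> blue_weight a n k \<ge> 0"
  using blue_coeff_pos[of a k] blue_coeff_pos[of a "n - k"] blue_norm_pos[of a n]
  by (simp add: blue_weight_def)

lemma sum_blue_weight: "a > -1/2 \<Longrightarrow> (\<Sum>k\<le>n. blue_weight a n k) = 1"
  using blue_norm_pos[of a n] sum_blue_coeff[of a n]
  by (simp add: blue_weight_def flip: sum_divide_distrib blue_norm_def)

lemma sum_acf_blue_weight:
  assumes "a > -1/2" "a \<noteq> 0" "j \<le> n"
  shows "(\<Sum>k\<le>n. acf a (int j - int k) * blue_weight a n k) = acf a 0 / blue_norm a n"
proof -
  have "(\<Sum>k\<le>n. acf a (int j - int k) * (blue_coeff a k * blue_coeff a (n - k))) = acf a 0"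
    using assms by (intro blue_normal_equations acf_minus acf_rec) auto
  then show ?thesis
    by (simp add: blue_weight_def flip: sum_divide_distrib)
qed

lemma poly_blue_poly: "poly (blue_poly a n) z = (\<Sum>k\<le>n. of_real (blue_weight a n k) * z ^ k)"
  by (simp add: blue_poly_def poly_sum poly_monom)

lemma degree_blue_poly: "degree (blue_poly a n) \<le> n"
  unfolding blue_poly_def by (intro degree_sum_le) (auto intro: order_trans[OF degree_monom_le])

lemma poly_blue_poly_1: "a > -1/2 \<Longrightarrow> poly (blue_poly a n) 1 = 1"
  by (simp add: poly_blue_poly sum_blue_weight flip: of_real_sum)

text \<open>A convex combination of points of the unit circle. This makes the error term in
  \<open>var_blu_upper\<close> uniform in \<open>n\<close>.\<close>

lemma cmod_blue_poly_le: "a > -1/2 \<Longrightarrow> cmod (poly (blue_poly a n) (cis x)) \<le> 1"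
  unfolding poly_blue_poly
  by (rule order_trans[OF norm_sum])
     (simp add: norm_mult norm_power blue_weight_nonneg sum_blue_weight)

text \<open>By the normal equations the quadratic form is a constant times the total weight
  1.\<close>

lemma risk_f_alpha_blue_poly:
  assumes "a > -1/2" "a \<noteq> 0"
  shows "risk (f_alpha a) (blue_poly a n) = acf a 0 / blue_norm a n"
proof -
  have "(cmod (poly (blue_poly a n) (cis x)))\<^sup>2
      = Re ((\<Sum>j\<le>n. of_real (blue_weight a n j) * cis x ^ j)
          * cnj (\<Sum>k\<le>n. of_real (blue_weight a n k) * cis x ^ k))" for x
    unfolding poly_blue_poly complex_norm_square[symmetric] by (simp only: Re_complex_of_real)
  then have "risk (f_alpha a) (blue_poly a n)
      = (\<Sum>j\<le>n. blue_weight a n j * (\<Sum>k\<le>n. acf a (int j - int k) * blue_weight a n k))"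
    by (simp only: risk_def integral_Re_poly_mult_cnj(2)[OF assms] Re_complex_of_real)
  also have "\<dots> = (\<Sum>j\<le>n. blue_weight a n j) * (acf a 0 / blue_norm a n)"
    unfolding sum_distrib_right by (intro sum.cong refl) (simp add: sum_acf_blue_weight[OF assms(1,2)])
  finally show ?thesis by (simp add: sum_blue_weight[OF assms(1)])
qed

text \<open>Let \<open>Q\<close> be the optimal polynomial. The coefficients of \<open>P - Q\<close>
  sum to 0 and the normal equations make all covariances with \<open>Q\<close> equal, so the cross
  term vanishes in the expansion of \<open>P = Q + (P - Q)\<close>; the square of
  \<open>P - Q\<close> is dropped.\<close>

lemma risk_f_alpha_ge:
  assumes "a > -1/2" "a \<noteq> 0" "degree P \<le> n" "poly P 1 = 1"
  shows "acf a 0 / blue_norm a n \<le> risk (f_alpha a) P"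
proof -
  let ?Q = "blue_poly a n"
  define d where "d j = coeff P j - of_real (blue_weight a n j)" for j
  have P: "poly P z = (\<Sum>j\<le>n. coeff P j * z ^ j)" for z
    by (subst poly_as_sum_of_monoms'[OF assms(3), symmetric]) (simp add: poly_sum poly_monom)
  define R where "R x = Re ((\<Sum>j\<le>n. d j * cis x ^ j)
      * cnj (\<Sum>k\<le>n. of_real (blue_weight a n k) * cis x ^ k))" for x
  have sum_d: "(\<Sum>j\<le>n. d j) = 0"
    using P[of 1] assms by (simp add: d_def sum_subtractf sum_blue_weight flip: of_real_sum)
  have int_R: "set_integrable lborel {-pi..pi} (\<lambda>x. R x * f_alpha a x)"
    unfolding R_def by (rule integral_Re_poly_mult_cnj(1)[OF assms(1,2)])
  have "(LINT x:{-pi..pi}|lborel. R x * f_alpha a x)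
      = (\<Sum>j\<le>n. Re (d j) * (\<Sum>k\<le>n. acf a (int j - int k) * blue_weight a n k))"
    unfolding R_def by (rule integral_Re_poly_mult_cnj(2)[OF assms(1,2)])
  also have "\<dots> = Re (\<Sum>j\<le>n. d j) * (acf a 0 / blue_norm a n)"
    unfolding Re_sum sum_distrib_right by (intro sum.cong refl) (simp add: sum_acf_blue_weight[OF assms(1,2)])
  finally have R0: "(LINT x:{-pi..pi}|lborel. R x * f_alpha a x) = 0"
    by (simp add: sum_d)
  have le: "(cmod (poly ?Q (cis x)))\<^sup>2 + 2 * R x \<le> (cmod (poly P (cis x)))\<^sup>2" for x
  proof -
    define q p where "q = poly ?Q (cis x)" and "p = poly P (cis x)"
    have "R x = Re ((p - q) * cnj q)"
      by (simp add: R_def q_def p_def P poly_blue_poly d_def left_diff_distrib sum_subtractf)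
    moreover have "(cmod q)\<^sup>2 + 2 * Re ((p - q) * cnj q) + (cmod (p - q))\<^sup>2 = (cmod p)\<^sup>2"
      unfolding cmod_power2 by (simp add: power2_eq_square algebra_simps)
    ultimately show ?thesis by (smt (verit) p_def q_def zero_le_power2)
  qed
  note int = set_integrable_risk[OF set_integrable_f_alpha[OF assms(1,2)]]
  have "acf a 0 / blue_norm a n
      = (LINT x:{-pi..pi}|lborel. (cmod (poly ?Q (cis x)))\<^sup>2 * f_alpha a x + 2 * (R x * f_alpha a x))"
    by (subst set_integral_add(2)) (use int int_R R0 risk_f_alpha_blue_poly[OF assms(1,2)] in \<open>auto simp: risk_def\<close>)
  also have "\<dots> \<le> risk (f_alpha a) P"
    unfolding risk_def
  proof (rule set_integral_mono)
    fix x
    show "(cmod (poly ?Q (cis x)))\<^sup>2 * f_alpha a x + 2 * (R x * f_alpha a x)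
        \<le> (cmod (poly P (cis x)))\<^sup>2 * f_alpha a x"
      using mult_right_mono[OF le f_alpha_nonneg] by (simp add: algebra_simps)
  qed (use int int_R in auto)
  finally show ?thesis .
qed

section \<open>Comparison of densities\<close>

lemma Gamma_series_pochhammer:
  "Gamma_series (z :: real) n = fact n * real n powr z / pochhammer z (Suc n)" if "n > 0"
  using that by (simp add: Gamma_series_def powr_def)

lemma blue_norm_asymp:
  assumes "a > -1/2"
  shows "(\<lambda>n. real n powr (1 + 2 * a) / blue_norm a n) \<longlonglongrightarrow> Gamma (2 * a + 2)"
proof -
  \<comment> \<open>\<open>Gamma_series\<close> contains \<open>pochhammer\<close> at
    \<open>Suc n\<close>; the second factor, which tends to 1, removes the surplus term
    \<open>2 * a + 2 + n\<close>.\<close>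
  have "(\<lambda>n. Gamma_series (2 * a + 2) n * ((2 * a + 2 + real n) / real n)) \<longlonglongrightarrow> Gamma (2 * a + 2) * 1"
    by (intro tendsto_intros) real_asymp
  moreover have "eventually (\<lambda>n. Gamma_series (2 * a + 2) n * ((2 * a + 2 + real n) / real n)
      = real n powr (1 + 2 * a) / blue_norm a n) sequentially"
    using eventually_gt_at_top[of 0]
  proof eventually_elim
    case (elim n)
    have "pochhammer (2 * a + 2) n > 0" "2 * a + 2 + real n > 0"
      using assms by (auto intro!: pochhammer_pos)
    moreover have "real n powr (2 * a + 2) = real n powr (1 + 2 * a) * real n"
      using elim powr_add[of "real n" "1 + 2 * a" 1] by (simp add: add_ac)
    ultimately show ?case
      using elim by (simp add: Gamma_series_pochhammer blue_norm_def pochhammer_Suc)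
  qed
  ultimately show ?thesis by (simp cong: filterlim_cong)
qed

definition peak_poly :: "nat \<Rightarrow> complex poly" where
  "peak_poly m = [:1/2, 1/2:] ^ m"

lemma degree_peak_poly: "degree (peak_poly m) \<le> m"
  unfolding peak_poly_def by (rule order_trans[OF degree_power_le]) simp

lemma poly_peak_poly_1: "poly (peak_poly m) 1 = 1"
  by (simp add: peak_poly_def poly_power)

lemma cmod_peak_poly: "(cmod (poly (peak_poly m) (cis x)))\<^sup>2 = (cos (x / 2))\<^sup>2 ^ m"
proof -
  have "(cmod ((1 + cis x) / 2))\<^sup>2 = (1 + cos x) / 2"
  proof -
    have "(1 + cos x)\<^sup>2 + (sin x)\<^sup>2 = 2 + 2 * cos x"
      by (simp add: power2_sum sin_squared_eq)
    then show ?thesis by (simp add: norm_divide power_divide cmod_power2)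
  qed
  also have "\<dots> = (cos (x / 2))\<^sup>2"
    using cos_double_cos[of "x / 2"] by simp
  finally have "(cmod ((1 + cis x) / 2))\<^sup>2 = (cos (x / 2))\<^sup>2" .
  moreover have "poly (peak_poly m) (cis x) = ((1 + cis x) / 2) ^ m"
    by (simp add: peak_poly_def poly_power add_divide_distrib)
  ultimately show ?thesis
    by (metis norm_power power_commutes power_mult mult.commute)
qed

lemma cos_half_le:
  assumes "0 \<le> d" "d \<le> \<bar>x\<bar>" "\<bar>x\<bar> \<le> pi"
  shows "(cos (x / 2))\<^sup>2 \<le> (cos (d / 2))\<^sup>2"
proof -
  have "cos (\<bar>x\<bar> / 2) \<le> cos (d / 2)"
    by (rule cos_monotone_0_pi_le) (use assms in auto)
  moreover have "cos (\<bar>x\<bar> / 2) \<ge> 0"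
    by (rule cos_ge_zero) (use assms in auto)
  ultimately have "(cos (\<bar>x\<bar> / 2))\<^sup>2 \<le> (cos (d / 2))\<^sup>2" by (intro power_mono)
  then show ?thesis by (cases "x \<ge> 0") auto
qed

text \<open>Inside \<open>d\<close> the peak factor is at most 1 and \<open>near\<close> applies;
  outside it is at most \<open>(cos (d / 2))\<^sup>2 ^ m\<close> and \<open>far\<close> applies. The
  upper bound for the BLUE uses \<open>f1 = f3 = f\<close>, \<open>T = 1\<close> and the pure
  density as \<open>f2\<close>; the lower bound uses the pure density as \<open>f1\<close> and
  \<open>f2 = f3 = f\<close>.\<close>

lemma risk_peak_le:
  assumes int: "set_integrable lborel {-pi..pi} f1" "set_integrable lborel {-pi..pi} f2"
      "set_integrable lborel {-pi..pi} f3"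
    and nonneg: "\<And>x. x \<in> {-pi..pi} \<Longrightarrow> f1 x \<ge> 0" "\<And>x. x \<in> {-pi..pi} \<Longrightarrow> f2 x \<ge> 0"
      "\<And>x. x \<in> {-pi..pi} \<Longrightarrow> f3 x \<ge> 0"
    and AB: "A \<ge> 0" "B \<ge> 0" and d: "0 \<le> d"
    and near: "\<And>x. x \<in> {-pi..pi} \<Longrightarrow> \<bar>x\<bar> < d \<Longrightarrow> (cmod (poly T (cis x)))\<^sup>2 * f1 x \<le> A * f2 x"
    and far: "\<And>x. x \<in> {-pi..pi} \<Longrightarrow> (cmod (poly T (cis x)))\<^sup>2 * f1 x \<le> B * f3 x"
  shows "risk f1 (P * T * peak_poly m) \<le> A * risk f2 P + B * (cos (d / 2))\<^sup>2 ^ m * risk f3 P"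
proof -
  have "risk f1 (P * T * peak_poly m) \<le> (LINT x:{-pi..pi}|lborel.
      A * ((cmod (poly P (cis x)))\<^sup>2 * f2 x) + B * (cos (d / 2))\<^sup>2 ^ m * ((cmod (poly P (cis x)))\<^sup>2 * f3 x))"
    unfolding risk_def
  proof (rule set_integral_mono)
    fix x assume x: "x \<in> {-pi..pi}"
    define p where "p = (cmod (poly P (cis x)))\<^sup>2"
    define t where "t = (cmod (poly T (cis x)))\<^sup>2 * f1 x"
    define c where "c = (cos (x / 2))\<^sup>2 ^ m"
    have p0: "p \<ge> 0" and t0: "t \<ge> 0" and c0: "c \<ge> 0"
      using nonneg(1)[OF x] by (simp_all add: p_def t_def c_def)
    have "t * c \<le> A * f2 x + B * (cos (d / 2))\<^sup>2 ^ m * f3 x"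
    proof (cases "\<bar>x\<bar> < d")
      case True
      have "c \<le> 1" unfolding c_def
        by (rule power_le_one[of "(cos (x / 2))\<^sup>2"]) (auto simp: abs_square_le_1)
      then have "t * c \<le> t" using t0 c0 by (simp add: mult_left_le)
      also have "\<dots> \<le> A * f2 x" using near[OF x True] by (simp add: t_def)
      finally show ?thesis using AB nonneg(3)[OF x] by (simp add: add_increasing2)
    next
      case False
      have "c \<le> (cos (d / 2))\<^sup>2 ^ m"
        unfolding c_def using x False d by (intro power_mono cos_half_le) auto
      then have "t * c \<le> (B * f3 x) * (cos (d / 2))\<^sup>2 ^ m"
        using far[OF x] t0 c0 by (intro mult_mono) (auto simp: t_def)
      then show ?thesis using AB nonneg(2)[OF x] by (simp add: add_increasing mult_ac)
    qed
    then have "p * (t * c) \<le> p * (A * f2 x + B * (cos (d / 2))\<^sup>2 ^ m * f3 x)"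
      using p0 by (rule mult_left_mono)
    moreover have "(cmod (poly (P * T * peak_poly m) (cis x)))\<^sup>2 * f1 x = p * (t * c)"
      by (simp add: norm_mult power_mult_distrib cmod_peak_poly p_def t_def c_def)
    ultimately show "(cmod (poly (P * T * peak_poly m) (cis x)))\<^sup>2 * f1 x
        \<le> A * ((cmod (poly P (cis x)))\<^sup>2 * f2 x) + B * (cos (d / 2))\<^sup>2 ^ m * ((cmod (poly P (cis x)))\<^sup>2 * f3 x)"
      by (simp add: p_def algebra_simps)
  qed (intro set_integral_add set_integrable_mult_right set_integrable_risk int)+
  also have "\<dots> = A * risk f2 P + B * (cos (d / 2))\<^sup>2 ^ m * risk f3 P"
    by (subst set_integral_add(2)) (auto simp: risk_def intro!: set_integrable_risk int)
  finally show ?thesis .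
qed

text \<open>The zeros of \<open>g\<close> are recorded by \<open>T\<close> and \<open>B\<close>:
  multiplied by the squared modulus of \<open>T\<close>, the pure density is at most
  \<open>B\<close> times the actual one. The normalisation of \<open>T\<close> at 1 preserves
  unbiasedness.\<close>

locale comparable_density =
  fixes a :: real and g :: "real \<Rightarrow> real" and T :: "complex poly" and B :: real
  assumes a_gt: "a > -1/2" and a_nz: "a \<noteq> 0"
    and g_nonneg: "\<And>x. x \<in> {-pi..pi} \<Longrightarrow> g x \<ge> 0"
    and g_cont: "isCont g 0" and g_0_pos: "g 0 > 0"
    and f_int: "set_integrable lborel {-pi..pi} (\<lambda>x. f_alpha a x * g x)"
    and T_1: "poly T 1 = 1"
    and T_le: "\<And>x. x \<in> {-pi..pi} \<Longrightarrow> (cmod (poly T (cis x)))\<^sup>2 \<le> B * g x"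
begin

abbreviation f :: "real \<Rightarrow> real" where
  "f \<equiv> \<lambda>x. f_alpha a x * g x"

lemma f_nonneg: "x \<in> {-pi..pi} \<Longrightarrow> f x \<ge> 0"
  by (simp add: f_alpha_nonneg g_nonneg)

lemma B_pos: "B > 0"
proof -
  have "1 \<le> B * g 0" using T_le[of 0] T_1 by simp
  then show ?thesis using g_0_pos by (smt (verit) zero_less_mult_pos2)
qed

lemma g_lt_near_0:
  assumes "g 0 < A"
  obtains d where "0 < d" "d < pi" "\<And>x. \<bar>x\<bar> < d \<Longrightarrow> g x < A"
proof -
  have "eventually (\<lambda>x. g x < A) (nhds 0)"
    using g_cont assms by (intro order_tendstoD(2)) (simp_all add: isCont_def tendsto_nhds_iff)
  then obtain d where d: "d > 0" "\<And>x. \<bar>x\<bar> < d \<Longrightarrow> g x < A"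
    by (auto simp: eventually_nhds_metric)
  show ?thesis by (rule that[of "min d 1"]) (use d pi_gt3 in auto)
qed

lemma g_gt_poly_near_0:
  assumes "A < g 0"
  obtains d where "0 < d" "d < pi" "\<And>x. \<bar>x\<bar> < d \<Longrightarrow> A * (cmod (poly T (cis x)))\<^sup>2 < g x"
proof -
  have "continuous_on UNIV (\<lambda>x. A * (cmod (poly T (cis x)))\<^sup>2)"
    by (intro continuous_intros)
  then have "isCont (\<lambda>x. g x - A * (cmod (poly T (cis x)))\<^sup>2) 0"
    by (intro continuous_diff g_cont) (simp add: continuous_on_eq_continuous_at)
  then have "((\<lambda>x. g x - A * (cmod (poly T (cis x)))\<^sup>2) \<longlongrightarrow> g 0 - A * (cmod (poly T (cis 0)))\<^sup>2) (nhds 0)"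
    by (simp add: tendsto_nhds_iff isCont_def)
  then have "eventually (\<lambda>x. g x - A * (cmod (poly T (cis x)))\<^sup>2 > 0) (nhds 0)"
    by (rule order_tendstoD(1)) (use assms T_1 in simp)
  then obtain d where d: "d > 0" "\<And>x. \<bar>x\<bar> < d \<Longrightarrow> g x - A * (cmod (poly T (cis x)))\<^sup>2 > 0"
    by (auto simp: eventually_nhds_metric)
  show ?thesis by (rule that[of "min d 1"]) (use d pi_gt3 in auto)
qed

text \<open>The optimal polynomial of the pure density times the peak factor competes for
  \<open>f\<close> at degree \<open>n + m\<close>. The constant \<open>K\<close> is the integral of
  \<open>f\<close>.\<close>

lemma var_blu_upper:
  assumes "g 0 < A"
  obtains d K where "0 < d" "d < pi"
    "\<And>n m. var_blu f (Suc (n + m)) \<le> A * (acf a 0 / blue_norm a n) + (cos (d / 2))\<^sup>2 ^ m * K"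
proof -
  obtain d where d: "0 < d" "d < pi" "\<And>x. \<bar>x\<bar> < d \<Longrightarrow> g x < A"
    using g_lt_near_0 assms by blast
  have "var_blu f (Suc (n + m)) \<le> A * (acf a 0 / blue_norm a n) + (cos (d / 2))\<^sup>2 ^ m * (LINT x:{-pi..pi}|lborel. f x)"
    for n m
  proof -
    let ?Q = "blue_poly a n"
    have "degree (?Q * 1 * peak_poly m) \<le> n + m"
      using degree_mult_le[of ?Q "peak_poly m"] degree_blue_poly[of a n] degree_peak_poly[of m] by simp
    moreover have "poly (?Q * 1 * peak_poly m) 1 = 1"
      by (simp add: poly_peak_poly_1 poly_blue_poly_1[OF a_gt])
    ultimately have "var_blu f (Suc (n + m)) \<le> risk f (?Q * 1 * peak_poly m)"
      by (intro var_blu_le_risk f_nonneg)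
    also have "\<dots> \<le> A * risk (f_alpha a) ?Q + 1 * (cos (d / 2))\<^sup>2 ^ m * risk f ?Q"
    proof (intro risk_peak_le f_int set_integrable_f_alpha a_gt a_nz f_nonneg f_alpha_nonneg)
      fix x assume "\<bar>x\<bar> < d"
      then show "(cmod (poly 1 (cis x)))\<^sup>2 * f x \<le> A * f_alpha a x"
        using mult_left_mono[OF less_imp_le[OF d(3)] f_alpha_nonneg[of a x]] by (simp add: mult.commute[of A])
    qed (use d assms g_0_pos in \<open>auto simp: less_imp_le[OF less_trans]\<close>)
    also have "risk f ?Q \<le> (LINT x:{-pi..pi}|lborel. f x)"
      unfolding risk_def
    proof (rule set_integral_mono[OF set_integrable_risk[OF f_int] f_int])
      fix x assume x: "x \<in> {-pi..pi}"
      show "(cmod (poly ?Q (cis x)))\<^sup>2 * f x \<le> f x"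
        using f_nonneg[OF x] cmod_blue_poly_le[OF a_gt]
        by (intro mult_left_le_one_le) (auto simp: power_le_one)
    qed
    finally show ?thesis
      by (simp add: risk_f_alpha_blue_poly[OF a_gt a_nz] mult_left_mono)
  qed
  then show ?thesis using d that by blast
qed

text \<open>Conversely, a competitor for \<open>f\<close> times \<open>T * peak_poly m\<close>
  competes for the pure density at degree \<open>n + degree T + m\<close>, where the minimum is
  known.\<close>

lemma var_blu_lower:
  assumes "0 < A" "A < g 0"
  obtains d where "0 < d" "d < pi"
    "\<And>n m. acf a 0 / blue_norm a (n + degree T + m)
      \<le> (1 / A + B * (cos (d / 2))\<^sup>2 ^ m) * var_blu f (Suc n)"
proof -
  obtain d where d: "0 < d" "d < pi" "\<And>x. \<bar>x\<bar> < d \<Longrightarrow> A * (cmod (poly T (cis x)))\<^sup>2 < g x"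
    using g_gt_poly_near_0 assms by blast
  have "acf a 0 / blue_norm a (n + degree T + m)
      \<le> (1 / A + B * (cos (d / 2))\<^sup>2 ^ m) * var_blu f (Suc n)" for n m
  proof -
    define C where "C = 1 / A + B * (cos (d / 2))\<^sup>2 ^ m"
    have C: "C > 0" using assms B_pos by (simp add: C_def add_pos_nonneg)
    have "acf a 0 / blue_norm a (n + degree T + m) / C \<le> var_blu f (Suc n)"
    proof (rule le_var_blu)
      fix P :: "complex poly" assume P: "degree P \<le> n" "poly P 1 = 1"
      have "degree (P * T * peak_poly m) \<le> n + degree T + m"
        using degree_mult_le[of "P * T" "peak_poly m"] degree_mult_le[of P T] P degree_peak_poly[of m]
        by linarith
      then have "acf a 0 / blue_norm a (n + degree T + m) \<le> risk (f_alpha a) (P * T * peak_poly m)"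
        by (intro risk_f_alpha_ge a_gt a_nz) (auto simp: P T_1 poly_peak_poly_1)
      also have "\<dots> \<le> 1 / A * risk f P + B * (cos (d / 2))\<^sup>2 ^ m * risk f P"
      proof (intro risk_peak_le f_int set_integrable_f_alpha a_gt a_nz f_nonneg f_alpha_nonneg)
        fix x assume "\<bar>x\<bar> < d"
        then have "(cmod (poly T (cis x)))\<^sup>2 \<le> 1 / A * g x"
          using d(3)[of x] assms by (simp add: field_simps)
        from mult_right_mono[OF this f_alpha_nonneg[of a x]]
        show "(cmod (poly T (cis x)))\<^sup>2 * f_alpha a x \<le> 1 / A * (f_alpha a x * g x)"
          by (simp add: mult_ac)
      next
        fix x assume "x \<in> {-pi..pi}"
        from mult_right_mono[OF T_le[OF this] f_alpha_nonneg[of a x]]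
        show "(cmod (poly T (cis x)))\<^sup>2 * f_alpha a x \<le> B * (f_alpha a x * g x)"
          by (simp add: mult_ac)
      qed (use assms d B_pos in auto)
      also have "\<dots> = C * risk f P"
        by (simp add: C_def distrib_right)
      finally show "acf a 0 / blue_norm a (n + degree T + m) / C \<le> risk f P"
        using C by (simp only: pos_divide_le_eq mult.commute)
    qed
    then show ?thesis using C unfolding C_def[symmetric] by (simp only: pos_divide_le_eq mult.commute)
  qed
  then show ?thesis using d that by blast
qed

end

section \<open>Asymptotics of the BLUE variance\<close>

text \<open>Passing from \<open>n\<close> to \<open>h n\<close> introduces only the factor
  \<open>(h n / n) powr (- p)\<close>, which tends to 1. This absorbs the change of degree in the
  two bounds above.\<close>

lemma regularly_varying_reindex:
  fixes v :: "nat \<Rightarrow> real" and h :: "nat \<Rightarrow> nat"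
  assumes v: "(\<lambda>n. real n powr p * v n) \<longlonglongrightarrow> L"
    and h: "(\<lambda>n. real (h n) / real n) \<longlonglongrightarrow> 1"
  shows "(\<lambda>n. real n powr p * v (h n)) \<longlonglongrightarrow> L"
proof -
  have ev: "eventually (\<lambda>n. real (h n) / real n > 1/2 \<and> n > 0) sequentially"
    by (intro eventually_conj order_tendstoD[OF h] eventually_gt_at_top) auto
  have "filterlim (\<lambda>n. real (h n)) at_top sequentially"
  proof (rule filterlim_at_top_mono)
    show "filterlim (\<lambda>n. real n / 2) at_top sequentially" by real_asymp
    show "eventually (\<lambda>n. real n / 2 \<le> real (h n)) sequentially"
      using ev by eventually_elim (auto simp: field_simps)
  qed
  then have h_top: "filterlim h at_top sequentially"
    by (simp add: filterlim_sequentially_iff_filterlim_real)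
  have "(\<lambda>n. (real (h n) / real n) powr (- p) * (real (h n) powr p * v (h n))) \<longlonglongrightarrow> 1 powr (- p) * L"
    by (intro tendsto_intros h filterlim_compose[OF v h_top]) auto
  moreover have "eventually (\<lambda>n. (real (h n) / real n) powr (- p) * (real (h n) powr p * v (h n))
      = real n powr p * v (h n)) sequentially"
    using ev
  proof eventually_elim
    case (elim n)
    then have "real (h n) > 0" by (cases "h n = 0") auto
    then show ?case using elim by (simp add: powr_divide powr_minus field_simps)
  qed
  ultimately show ?thesis by (simp cong: filterlim_cong)
qed

text \<open>The exponent for the peak factor: \<open>o(n)\<close>, so that the degree changes
  negligibly, yet large enough for \<open>q ^ nat_sqrt n\<close> with \<open>0 < q < 1\<close> to
  beat every power of \<open>n\<close>.\<close>

definition nat_sqrt :: "nat \<Rightarrow> nat" where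
  "nat_sqrt n = nat \<lfloor>sqrt (real n)\<rfloor>"

lemma nat_sqrt_le: "nat_sqrt n \<le> n"
proof -
  have "real n \<le> real n * real n" by (cases n) auto
  then have "sqrt (real n) \<le> real n" by (intro real_le_lsqrt) (auto simp: power2_eq_square)
  then show ?thesis unfolding nat_sqrt_def by linarith
qed

lemma real_nat_sqrt: "sqrt (real n) - 1 \<le> real (nat_sqrt n)" "real (nat_sqrt n) \<le> sqrt (real n)"
  unfolding nat_sqrt_def using of_nat_floor[of "sqrt (real n)"] by (linarith, simp)

lemma nat_sqrt_over_tendsto: "(\<lambda>n. real (nat_sqrt n) / real n) \<longlonglongrightarrow> 0"
proof (rule tendsto_sandwich)
  show "eventually (\<lambda>n. 0 \<le> real (nat_sqrt n) / real n) sequentially" by simp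
  show "eventually (\<lambda>n. real (nat_sqrt n) / real n \<le> sqrt (real n) / real n) sequentially"
    by (intro always_eventually allI divide_right_mono real_nat_sqrt) auto
qed real_asymp+

lemma powr_mult_power_nat_sqrt_tendsto:
  fixes p q :: real
  assumes "0 < q" "q < 1"
  shows "(\<lambda>n. real n powr p * q ^ nat_sqrt n) \<longlonglongrightarrow> 0"
proof (rule tendsto_sandwich)
  define k where "k = - ln q"
  have k: "k > 0" using assms by (simp add: k_def)
  show "eventually (\<lambda>n. 0 \<le> real n powr p * q ^ nat_sqrt n) sequentially"
    using assms by simp
  show "eventually (\<lambda>n. real n powr p * q ^ nat_sqrt n \<le> real n powr p * exp (- k * (sqrt (real n) - 1))) sequentially"
  proof (intro always_eventually allI mult_left_mono)
    fix n
    have "q ^ nat_sqrt n = exp (- k * real (nat_sqrt n))"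
      using assms by (simp add: k_def exp_of_nat2_mult flip: ln_realpow)
    also have "\<dots> \<le> exp (- k * (sqrt (real n) - 1))"
      using k real_nat_sqrt(1)[of n] by simp
    finally show "q ^ nat_sqrt n \<le> exp (- k * (sqrt (real n) - 1))" .
  qed simp
  show "(\<lambda>n. real n powr p * exp (- k * (sqrt (real n) - 1))) \<longlonglongrightarrow> 0"
    using k by real_asymp
qed simp

lemma cos_half_power2:
  assumes "0 < d" "d < pi"
  shows "0 < (cos (d / 2))\<^sup>2" "(cos (d / 2))\<^sup>2 < 1"
proof -
  have "cos (d / 2) > 0" using assms by (intro cos_gt_zero_pi) auto
  then show "0 < (cos (d / 2))\<^sup>2" by simp
  have "sin (d / 2) > 0" using assms by (intro sin_gt_zero) auto
  then have "(sin (d / 2))\<^sup>2 > 0" by simp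
  then show "(cos (d / 2))\<^sup>2 < 1" using sin_cos_squared_add[of "d / 2"] by linarith
qed

context comparable_density
begin

definition L :: real where "L = acf a 0 * Gamma (2 * a + 2)"

lemma L_pos: "L > 0"
  using acf_0_pos[OF a_gt a_nz] a_gt by (simp add: L_def Gamma_real_pos)

text \<open>Each level \<open>A\<close> above or below \<open>g 0\<close> gives a one-sided bound
  with limit \<open>A * L\<close>, the peak error being negligible for
  \<open>m = nat_sqrt n\<close>; and \<open>A\<close> may be taken arbitrarily close to
  \<open>g 0\<close>.\<close>

lemma var_blu_asymp:
  "(\<lambda>n. real n powr (1 + 2 * a) * var_blu f (Suc n)) \<longlonglongrightarrow> g 0 * L"
proof -
  define v where "v n = acf a 0 / blue_norm a n" for n
  define p where "p = 1 + 2 * a"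
  have "(\<lambda>n. acf a 0 * (real n powr p / blue_norm a n)) \<longlonglongrightarrow> L"
    unfolding p_def L_def by (intro tendsto_mult_left blue_norm_asymp a_gt)
  then have v: "(\<lambda>n. real n powr p * v n) \<longlonglongrightarrow> L"
    by (simp add: v_def mult_ac)
  have v1: "(\<lambda>n. real n powr p * v (n - nat_sqrt n)) \<longlonglongrightarrow> L"
  proof (rule regularly_varying_reindex[OF v])
    have "(\<lambda>n. 1 - real (nat_sqrt n) / real n) \<longlonglongrightarrow> 1 - 0"
      by (intro tendsto_intros nat_sqrt_over_tendsto)
    moreover have "eventually (\<lambda>n. 1 - real (nat_sqrt n) / real n = real (n - nat_sqrt n) / real n) sequentially"
      using eventually_gt_at_top[of 0]
      by eventually_elim (simp add: of_nat_diff nat_sqrt_le field_simps)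
    ultimately show "(\<lambda>n. real (n - nat_sqrt n) / real n) \<longlonglongrightarrow> 1"
      by (simp cong: filterlim_cong)
  qed
  have v2: "(\<lambda>n. real n powr p * v (n + degree T + nat_sqrt n)) \<longlonglongrightarrow> L"
  proof (rule regularly_varying_reindex[OF v])
    have "(\<lambda>n. 1 + real (degree T) / real n + real (nat_sqrt n) / real n) \<longlonglongrightarrow> 1 + 0 + 0"
      by (intro tendsto_intros nat_sqrt_over_tendsto)
    moreover have "eventually (\<lambda>n. 1 + real (degree T) / real n + real (nat_sqrt n) / real n
        = real (n + degree T + nat_sqrt n) / real n) sequentially"
      using eventually_gt_at_top[of 0]
      by eventually_elim (simp add: field_simps)
    ultimately show "(\<lambda>n. real (n + degree T + nat_sqrt n) / real n) \<longlonglongrightarrow> 1"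
      by (simp cong: filterlim_cong)
  qed
  have "(\<lambda>n. real n powr p * var_blu f (Suc n)) \<longlonglongrightarrow> g 0 * L"
  proof (rule order_tendstoI)
    fix b assume b: "b > g 0 * L"
    then have "g 0 < b / L" using L_pos by (simp add: field_simps)
    then obtain A where A: "g 0 < A" "A < b / L" using dense by blast
    obtain d K where d: "0 < d" "d < pi"
      and le: "\<And>n m. var_blu f (Suc (n + m)) \<le> A * v n + (cos (d / 2))\<^sup>2 ^ m * K"
      using var_blu_upper[OF A(1)] unfolding v_def by blast
    have "(\<lambda>n. A * (real n powr p * v (n - nat_sqrt n))
        + (real n powr p * (cos (d / 2))\<^sup>2 ^ nat_sqrt n) * K) \<longlonglongrightarrow> A * L + 0 * K"
      by (intro tendsto_intros v1 powr_mult_power_nat_sqrt_tendsto cos_half_power2 d)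
    then have "eventually (\<lambda>n. A * (real n powr p * v (n - nat_sqrt n))
        + (real n powr p * (cos (d / 2))\<^sup>2 ^ nat_sqrt n) * K < b) sequentially"
      by (rule order_tendstoD(2)) (use A L_pos in \<open>simp add: field_simps\<close>)
    then show "eventually (\<lambda>n. real n powr p * var_blu f (Suc n) < b) sequentially"
    proof eventually_elim
      case (elim n)
      \<comment> \<open>The degree \<open>n\<close> is split into \<open>n - nat_sqrt n\<close> and
        \<open>nat_sqrt n\<close>.\<close>
      have "real n powr p * var_blu f (Suc n)
          \<le> real n powr p * (A * v (n - nat_sqrt n) + (cos (d / 2))\<^sup>2 ^ nat_sqrt n * K)"
        using le[of "n - nat_sqrt n" "nat_sqrt n"] nat_sqrt_le[of n] by (intro mult_left_mono) auto
      then show ?case using elim by (simp add: algebra_simps)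
    qed
  next
    fix b assume b: "b < g 0 * L"
    \<comment> \<open>The maximum with \<open>g 0 / 2\<close> keeps \<open>A\<close> positive even
      if \<open>b\<close> is negative.\<close>
    then have "max (b / L) (g 0 / 2) < g 0" using L_pos g_0_pos by (simp add: field_simps)
    then obtain A where "max (b / L) (g 0 / 2) < A" "A < g 0" using dense by blast
    then have A: "0 < A" "A < g 0" "b < A * L" using L_pos g_0_pos by (auto simp: field_simps)
    obtain d where d: "0 < d" "d < pi"
      and le: "\<And>n m. v (n + degree T + m) \<le> (1 / A + B * (cos (d / 2))\<^sup>2 ^ m) * var_blu f (Suc n)"
      using var_blu_lower[OF A(1,2)] unfolding v_def by blast
    \<comment> \<open>The factor \<open>real n powr 0\<close>, equal to 1 for \<open>n > 0\<close>,
      brings the error into the form of \<open>powr_mult_power_nat_sqrt_tendsto\<close>.\<close>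
    have "(\<lambda>n. real n powr p * v (n + degree T + nat_sqrt n)
        / (1 / A + B * (real n powr 0 * (cos (d / 2))\<^sup>2 ^ nat_sqrt n))) \<longlonglongrightarrow> L / (1 / A + B * 0)"
      by (intro tendsto_intros v2 powr_mult_power_nat_sqrt_tendsto cos_half_power2 d) (use A in auto)
    then have "eventually (\<lambda>n. b < real n powr p * v (n + degree T + nat_sqrt n)
        / (1 / A + B * (real n powr 0 * (cos (d / 2))\<^sup>2 ^ nat_sqrt n))) sequentially"
      by (rule order_tendstoD(1)) (use A in \<open>simp add: mult.commute\<close>)
    then show "eventually (\<lambda>n. b < real n powr p * var_blu f (Suc n)) sequentially"
      using eventually_gt_at_top[of 0]
    proof eventually_elim
      case (elim n)
      define C where "C = 1 / A + B * (cos (d / 2))\<^sup>2 ^ nat_sqrt n"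
      have C: "C > 0" using A B_pos by (simp add: C_def add_pos_nonneg)
      have "b < real n powr p * v (n + degree T + nat_sqrt n) / C"
        using elim by (simp add: C_def)
      also have "\<dots> \<le> real n powr p * (C * var_blu f (Suc n)) / C"
        using le[of n "nat_sqrt n"] C unfolding C_def by (intro divide_right_mono mult_left_mono) auto
      finally show ?case using C by simp
    qed
  qed
  then show ?thesis by (simp add: p_def)
qed

end

section \<open>The sample mean\<close>

text \<open>The Dirichlet kernel without the factor \<open>1 / n\<close>, so that weights do not
  change with \<open>n\<close> and the risk can be computed by adding one observation at a
  time.\<close>

definition dirichlet_poly :: "nat \<Rightarrow> complex poly" where
  "dirichlet_poly n = (\<Sum>k<n. monom 1 k)"

lemma poly_dirichlet_poly: "poly (dirichlet_poly n) z = (\<Sum>k<n. z ^ k)"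
  by (simp add: dirichlet_poly_def poly_sum poly_monom)

lemma var_mean_eq_risk: "var_mean f n = risk f (dirichlet_poly n) / (real n)\<^sup>2"
proof -
  have "(cmod (\<Sum>k<n. 1 / of_nat n * exp (\<i> * of_nat k * of_real x)))\<^sup>2 * f x
      = (cmod (poly (dirichlet_poly n) (cis x)))\<^sup>2 * f x / (real n)\<^sup>2" for x
    by (simp add: exp_eq_cis_power poly_dirichlet_poly norm_divide power_divide flip: sum_divide_distrib)
  then show ?thesis
    by (simp add: var_mean_def risk_def)
qed

text \<open>The geometric sum, multiplied out so that it also holds at \<open>x = 0\<close>.\<close>

lemma cmod_dirichlet_poly:
  "(cmod (poly (dirichlet_poly n) (cis x)))\<^sup>2 * (2 * sin (x / 2))\<^sup>2 = 2 - 2 * cos (real n * x)"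
proof -
  have sq: "(cmod (1 - cis y))\<^sup>2 = 2 - 2 * cos y" for y
    using sin_cos_squared_add[of y] by (simp add: cmod_power2 power2_diff)
  have "(1 - cis x) * poly (dirichlet_poly n) (cis x) = 1 - cis (real n * x)"
    by (simp add: poly_dirichlet_poly one_diff_power_eq Complex.DeMoivre[symmetric])
  then have "(cmod (1 - cis x))\<^sup>2 * (cmod (poly (dirichlet_poly n) (cis x)))\<^sup>2 = 2 - 2 * cos (real n * x)"
    using sq by (metis norm_mult power_mult_distrib)
  moreover have "(cmod (1 - cis x))\<^sup>2 = (2 * sin (x / 2))\<^sup>2"
    using cos_double_sin[of "x / 2"] by (simp add: sq power_mult_distrib)
  ultimately show ?thesis by (simp add: mult.commute)
qed

lemma risk_f_alpha_dirichlet: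
  assumes "a > -1/2" "a \<noteq> 0"
  shows "risk (f_alpha a) (dirichlet_poly (Suc n)) = (\<Sum>j\<le>n. \<Sum>k\<le>n. acf a (int j - int k))"
proof -
  have "(cmod (poly (dirichlet_poly (Suc n)) (cis x)))\<^sup>2
      = Re ((\<Sum>j\<le>n. 1 * cis x ^ j) * cnj (\<Sum>k\<le>n. of_real 1 * cis x ^ k))" for x
    unfolding poly_dirichlet_poly lessThan_Suc_atMost mult_1 of_real_1 complex_norm_square[symmetric]
    by (simp only: Re_complex_of_real)
  then have "risk (f_alpha a) (dirichlet_poly (Suc n))
      = (\<Sum>j\<le>n. Re 1 * (\<Sum>k\<le>n. acf a (int j - int k) * 1))"
    by (simp only: risk_def integral_Re_poly_mult_cnj(2)[OF assms])
  then show ?thesis by simp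
qed

text \<open>\<open>acf_rec\<close> makes the sum over the lags \<open>-m\<close> to \<open>m\<close>
  telescope. These sums are the increments of the variance of partial sums.\<close>

lemma sum_acf:
  assumes "a > -1/2" "a \<noteq> 0"
  shows "acf a 0 + 2 * (\<Sum>k<m. acf a (int k + 1)) = (a - real m) / a * acf a (int m)"
proof (induction m)
  case 0
  then show ?case using assms by simp
next
  case (Suc m)
  have "acf a 0 + 2 * (\<Sum>k<Suc m. acf a (int k + 1))
      = (a - real m) / a * acf a (int m) + 2 * acf a (int m + 1)"
    using Suc.IH by simp
  also have "\<dots> = ((a - real m) * acf a (int m) + 2 * a * acf a (int m + 1)) / a"
    using assms by (simp add: field_simps)
  also have "(a - real m) * acf a (int m) = - ((real m + 1 + a) * acf a (int m + 1))"
    using acf_rec[OF assms, of "int m"] by (simp add: algebra_simps)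
  also have "(- ((real m + 1 + a) * acf a (int m + 1)) + 2 * a * acf a (int m + 1)) / a
      = (a - real (Suc m)) / a * acf a (int (Suc m))"
    by (simp add: algebra_simps)
  finally show ?case .
qed

lemma risk_f_alpha_dirichlet_eq_sum:
  assumes "a > -1/2" "a \<noteq> 0"
  shows "risk (f_alpha a) (dirichlet_poly n) = (\<Sum>m<n. (a - real m) / a * acf a (int m))"
proof (induction n)
  case 0
  then show ?case by (simp add: risk_def dirichlet_poly_def)
next
  case (Suc n)
  let ?r = "\<lambda>j k. acf a (int j - int k)"
  have "risk (f_alpha a) (dirichlet_poly (Suc n))
      = risk (f_alpha a) (dirichlet_poly n) + (a - real n) / a * acf a (int n)"
  proof (cases n)
    case 0
    moreover have "risk (f_alpha a) (dirichlet_poly 0) = 0"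
      by (simp add: risk_def dirichlet_poly_def)
    ultimately show ?thesis
      using risk_f_alpha_dirichlet[OF assms, of 0] assms by simp
  next
    case (Suc l)
    have "(\<Sum>k\<le>l. ?r n k) = (\<Sum>k<n. acf a (int k + 1))"
      unfolding Suc lessThan_Suc_atMost[symmetric]
      by (subst sum.nat_diff_reindex[symmetric]) (auto intro!: sum.cong simp: add.commute)
    moreover have "(\<Sum>j\<le>l. ?r j n) = (\<Sum>k\<le>l. ?r n k)"
      by (intro sum.cong refl) (metis acf_minus minus_diff_eq)
    \<comment> \<open>One more observation adds a row, a column and a diagonal entry to the Toeplitz
      matrix, together the lags \<open>-n\<close> to \<open>n\<close>.\<close>
    moreover have "(\<Sum>j\<le>n. \<Sum>k\<le>n. ?r j k)
        = (\<Sum>j\<le>l. \<Sum>k\<le>l. ?r j k) + (\<Sum>j\<le>l. ?r j n) + (\<Sum>k\<le>l. ?r n k) + acf a 0"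
      by (simp add: Suc sum.distrib)
    ultimately show ?thesis
      using risk_f_alpha_dirichlet[OF assms, of n] risk_f_alpha_dirichlet[OF assms, of l]
        sum_acf[OF assms, of n] by (simp add: Suc)
  qed
  then show ?case by (simp add: Suc.IH)
qed

text \<open>A second telescoping. At \<open>a = 1/2\<close> the summands are of order
  \<open>1 / m\<close> and the sum is logarithmic, hence the exclusion.\<close>

lemma risk_f_alpha_dirichlet_closed_form:
  assumes "a > -1/2" "a \<noteq> 0" "a \<noteq> 1/2"
  shows "risk (f_alpha a) (dirichlet_poly n)
    = ((a\<^sup>2 - (real n)\<^sup>2) * acf a (int n) - a\<^sup>2 * acf a 0) / (a * (1 - 2 * a))"
  unfolding risk_f_alpha_dirichlet_eq_sum[OF assms(1,2)]
proof (induction n)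
  case 0
  then show ?case by simp
next
  case (Suc n)
  define r0 r r' N where "r0 = acf a 0" and "r = acf a (int n)" and "r' = acf a (int (Suc n))"
    and "N = real n"
  have rec: "(N + 1 + a) * r' = (N - a) * r"
    using acf_rec[OF assms(1,2), of "int n"] by (simp add: N_def r_def r'_def add_ac)
  have nz: "a * (1 - 2 * a) \<noteq> 0" using assms by simp
  have "(a\<^sup>2 - (N + 1)\<^sup>2) * r' = (a - (N + 1)) * ((N - a) * r)"
    unfolding rec[symmetric] by (simp add: power2_eq_square algebra_simps)
  then have "(a\<^sup>2 - N\<^sup>2) * r - a\<^sup>2 * r0 + (1 - 2 * a) * ((a - N) * r) = (a\<^sup>2 - (N + 1)\<^sup>2) * r' - a\<^sup>2 * r0"
    by (simp add: power2_eq_square algebra_simps)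
  moreover have "((a\<^sup>2 - N\<^sup>2) * r - a\<^sup>2 * r0) / (a * (1 - 2 * a)) + (a - N) / a * r
     = ((a\<^sup>2 - N\<^sup>2) * r - a\<^sup>2 * r0 + (1 - 2 * a) * ((a - N) * r)) / (a * (1 - 2 * a))"
    using nz by (simp add: add_divide_distrib)
  ultimately show ?case
    using Suc.IH by (simp add: r0_def r_def r'_def N_def add.commute)
qed

lemma acf_eq_pochhammer:
  assumes "a > -1/2" "a \<noteq> 0"
  shows "acf a (int n) = acf a 0 * pochhammer (- a) n / pochhammer (1 + a) n"
proof (induction n)
  case 0
  then show ?case by simp
next
  case (Suc n)
  have pos: "pochhammer (1 + a) n > 0" "1 + a + real n > 0"
    using assms by (auto intro!: pochhammer_pos)
  have "(real n + 1 + a) * acf a (int (Suc n)) = (real n - a) * acf a (int n)"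
    using acf_rec[OF assms, of "int n"] by (simp add: add_ac)
  then have "acf a (int (Suc n)) = (real n - a) * acf a (int n) / (1 + a + real n)"
    using pos by (simp add: field_simps)
  then show ?case
    using pos unfolding Suc.IH by (simp add: pochhammer_Suc mult_ac)
qed

text \<open>In the product of \<open>rGamma_series (- a)\<close> and
  \<open>Gamma_series (1 + a)\<close> the factorials cancel and the pochhammers form the ratio for
  lag \<open>Suc n\<close>. For positive integers \<open>a\<close> the value of
  \<open>rGamma\<close> is 0.\<close>

lemma acf_asymp:
  assumes "a > -1/2" "a \<noteq> 0"
  shows "(\<lambda>n. real n powr (1 + 2 * a) * acf a (int (Suc n))) \<longlonglongrightarrow> acf a 0 * rGamma (- a) * Gamma (1 + a)"
proof -
  have "(\<lambda>n. acf a 0 * rGamma_series (- a) n * Gamma_series (1 + a) n)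
      \<longlonglongrightarrow> acf a 0 * rGamma (- a) * Gamma (1 + a)"
    by (intro tendsto_intros)
  moreover have "eventually (\<lambda>n. acf a 0 * rGamma_series (- a) n * Gamma_series (1 + a) n
      = real n powr (1 + 2 * a) * acf a (int (Suc n))) sequentially"
    using eventually_gt_at_top[of 0]
  proof eventually_elim
    case (elim n)
    have r: "rGamma_series (- a) n = pochhammer (- a) (Suc n) / (fact n * real n powr (- a))"
      using elim by (simp add: rGamma_series_def powr_def)
    have p: "real n powr (1 + a) = real n powr (1 + 2 * a) * real n powr (- a)"
      by (simp add: add.commute flip: powr_add)
    have "real n powr (- a) > 0" using elim by simp
    then show ?case
      unfolding r Gamma_series_pochhammer[OF elim] acf_eq_pochhammer[OF assms] p by simp
  qed
  ultimately show ?thesis by (simp cong: filterlim_cong)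
qed

text \<open>In the closed form the term with \<open>acf a n\<close> is of order
  \<open>n powr (1 - 2 * a)\<close> and dominates the constant because
  \<open>a < 1/2\<close>.\<close>

lemma risk_f_alpha_dirichlet_asymp:
  assumes "a > -1/2" "a < 1/2" "a \<noteq> 0"
  shows "(\<lambda>n. real n powr (2 * a - 1) * risk (f_alpha a) (dirichlet_poly (Suc n)))
    \<longlonglongrightarrow> acf a 0 * (Gamma (1 + a) / ((1 - 2 * a) * Gamma (1 - a)))"
proof -
  define c where "c = a * (1 - 2 * a)"
  have c: "c \<noteq> 0" using assms by (simp add: c_def)
  have z: "(\<lambda>n. real n powr (2 * a - 1)) \<longlonglongrightarrow> 0"
    using assms by real_asymp
  have lim: "(\<lambda>n. ((a\<^sup>2 - (real (Suc n))\<^sup>2) / (real n)\<^sup>2 * (real n powr (1 + 2 * a) * acf a (int (Suc n)))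
      - a\<^sup>2 * acf a 0 * real n powr (2 * a - 1)) / c)
    \<longlonglongrightarrow> ((-1) * (acf a 0 * rGamma (- a) * Gamma (1 + a)) - a\<^sup>2 * acf a 0 * 0) / c"
    by (intro tendsto_intros z acf_asymp assms c) real_asymp
  have ev: "eventually (\<lambda>n. ((a\<^sup>2 - (real (Suc n))\<^sup>2) / (real n)\<^sup>2 * (real n powr (1 + 2 * a) * acf a (int (Suc n)))
      - a\<^sup>2 * acf a 0 * real n powr (2 * a - 1)) / c
     = real n powr (2 * a - 1) * risk (f_alpha a) (dirichlet_poly (Suc n))) sequentially"
    using eventually_gt_at_top[of 0]
  proof eventually_elim
    case (elim n)
    have "real n powr (1 + 2 * a) = real n powr (2 * a - 1) * (real n)\<^sup>2"
      using elim powr_add[of "real n" "2 * a - 1" 2] by (simp add: powr_numeral add.commute)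
    moreover have "(k / y * (w * y * s) - q * w) / c = w * ((k * s - q) / c)"
      if "y \<noteq> 0" for k y w s q :: real
      using that by (simp add: algebra_simps diff_divide_distrib)
    moreover have "risk (f_alpha a) (dirichlet_poly (Suc n))
        = ((a\<^sup>2 - (real (Suc n))\<^sup>2) * acf a (int (Suc n)) - a\<^sup>2 * acf a 0) / c"
      unfolding c_def using assms by (intro risk_f_alpha_dirichlet_closed_form) auto
    moreover have "(real n)\<^sup>2 \<noteq> 0" using elim by simp
    ultimately show ?case by (simp only:)
  qed
  \<comment> \<open>Writing \<open>rGamma (- a)\<close> as \<open>- a / Gamma (1 - a)\<close>
    cancels the sign and the factor \<open>a\<close> of \<open>c\<close>.\<close>
  have eq: "((-1) * (acf a 0 * rGamma (- a) * Gamma (1 + a)) - a\<^sup>2 * acf a 0 * 0) / c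
      = acf a 0 * (Gamma (1 + a) / ((1 - 2 * a) * Gamma (1 - a)))"
  proof -
    have "Gamma (1 - a) > 0" using assms by (intro Gamma_real_pos) simp
    moreover have "rGamma (- a) = - a / Gamma (1 - a)"
      using rGamma_plus1[of "- a"] by (simp add: rGamma_inverse_Gamma[of "1 - a"] divide_inverse)
    ultimately show ?thesis using assms by (simp add: c_def)
  qed
  show ?thesis using Lim_transform_eventually[OF lim ev] unfolding eq .
qed

lemma risk_f_alpha_dirichlet_at_top:
  assumes "a > -1/2" "a \<le> 1/2" "a \<noteq> 0"
  shows "filterlim (\<lambda>n. risk (f_alpha a) (dirichlet_poly (Suc n))) at_top sequentially"
proof (cases "a = 1/2")
  case False
  define l where "l = acf a 0 * (Gamma (1 + a) / ((1 - 2 * a) * Gamma (1 - a)))"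
  have l: "l > 0"
    using assms False acf_0_pos[of a] unfolding l_def
    by (intro mult_pos_pos divide_pos_pos Gamma_real_pos) auto
  have lim: "(\<lambda>n. real n powr (2 * a - 1) * risk (f_alpha a) (dirichlet_poly (Suc n))) \<longlonglongrightarrow> l"
    unfolding l_def using assms False by (intro risk_f_alpha_dirichlet_asymp) auto
  have "filterlim (\<lambda>n. real n powr (1 - 2 * a)) at_top sequentially"
    using assms False by real_asymp
  from filterlim_tendsto_pos_mult_at_top[OF lim l this]
  show ?thesis
  proof (rule filterlim_mono_eventually)
    show "eventually (\<lambda>n. real n powr (2 * a - 1) * risk (f_alpha a) (dirichlet_poly (Suc n)) * real n powr (1 - 2 * a)
        = risk (f_alpha a) (dirichlet_poly (Suc n))) sequentially"
      using eventually_gt_at_top[of 0]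
    proof eventually_elim
      case (elim n)
      have "real n powr (2 * a - 1) * real n powr (1 - 2 * a) = 1"
        using elim by (simp flip: powr_add)
      then show ?case by (simp add: mult_ac)
    qed
  qed auto
next
  case True
  \<comment> \<open>At \<open>a = 1/2\<close> the summands are \<open>acf a 0\<close> times
    reciprocals of odd numbers, so the risk dominates a multiple of the harmonic sum.\<close>
  have s: "(a - real m) / a * acf a (int m) = acf a 0 / (2 * real m + 1)" for m
  proof (induction m)
    case 0
    then show ?case using assms by simp
  next
    case (Suc m)
    have "(real m + 1 + a) * acf a (int (Suc m)) = (real m - a) * acf a (int m)"
      using acf_rec[OF assms(1,3), of "int m"] by (simp add: add_ac)
    moreover have "real m + 1 + a = real m + 3/2" "real m - a = real m - 1/2" "(a - real m) / a = 1 - 2 * real m"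
      "(a - real (Suc m)) / a = - (2 * real m + 1)"
      unfolding True by simp_all
    note c = this
    ultimately have "(real m + 3/2) * acf a (int (Suc m)) = (real m - 1/2) * acf a (int m)"
      by (simp only:)
    moreover have "(1 - 2 * real m) * acf a (int m) = acf a 0 / (2 * real m + 1)"
      using Suc.IH unfolding c .
    ultimately have "(2 * real m + 3) * acf a (int (Suc m)) = - (acf a 0 / (2 * real m + 1))"
      by (simp add: algebra_simps)
    then have "acf a (int (Suc m)) = - (acf a 0 / (2 * real m + 1)) / (2 * real m + 3)"
      by (metis add_pos_nonneg less_numeral_extra(3) mult.commute mult_nonneg_nonneg nonzero_eq_divide_eq
          of_nat_0_le_iff add.commute zero_le_numeral zero_less_numeral)
    then show ?case unfolding c by (simp add: divide_simps) (simp add: algebra_simps)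
  qed
  have "filterlim (\<lambda>n. acf a 0 / 2 * harm (Suc n)) at_top sequentially"
    using acf_0_pos[OF assms(1,3)]
    by (intro filterlim_tendsto_pos_mult_at_top[OF tendsto_const]
        filterlim_compose[OF harm_at_top filterlim_Suc]) auto
  then show ?thesis
  proof (rule filterlim_at_top_mono, intro always_eventually allI)
    fix n
    have "acf a 0 / 2 * harm (Suc n) = (\<Sum>m<Suc n. acf a 0 / (2 * real (Suc m)))"
      unfolding harm_altdef sum_distrib_left by (simp add: field_simps)
    also have "\<dots> \<le> (\<Sum>m<Suc n. acf a 0 / (2 * real m + 1))"
      using acf_0_pos[OF assms(1,3)] by (intro sum_mono divide_left_mono) auto
    finally show "acf a 0 / 2 * harm (Suc n) \<le> risk (f_alpha a) (dirichlet_poly (Suc n))"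
      by (simp only: risk_f_alpha_dirichlet_eq_sum[OF assms(1,3)] s)
  qed
qed

section \<open>Transfer of the variance of the mean to the actual density\<close>

text \<open>The right-hand side of \<open>cmod_dirichlet_poly\<close> is at most 4 whatever
  \<open>n\<close> is, and the sine is bounded away from 0 beyond \<open>d\<close>.\<close>

lemma dirichlet_far:
  assumes "0 < d" "d \<le> \<bar>x\<bar>" "\<bar>x\<bar> \<le> pi"
  shows "(cmod (poly (dirichlet_poly n) (cis x)))\<^sup>2 \<le> 1 / (sin (d / 2))\<^sup>2"
proof -
  have "sin (d / 2) > 0" using assms by (intro sin_gt_zero) auto
  then have s1: "0 < (sin (d / 2))\<^sup>2" by simp
  have "(cos (x / 2))\<^sup>2 \<le> (cos (d / 2))\<^sup>2"
    using assms by (intro cos_half_le) auto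
  then have s2: "(sin (d / 2))\<^sup>2 \<le> (sin (x / 2))\<^sup>2"
    by (simp add: sin_squared_eq)
  define D where "D = (cmod (poly (dirichlet_poly n) (cis x)))\<^sup>2"
  have "D * (2 * sin (x / 2))\<^sup>2 \<le> 4"
    unfolding D_def cmod_dirichlet_poly using cos_ge_minus_one[of "real n * x"] by linarith
  moreover have "D * (sin (d / 2))\<^sup>2 \<le> D * (sin (x / 2))\<^sup>2"
    using s2 by (intro mult_left_mono) (auto simp: D_def)
  ultimately have "D * (sin (d / 2))\<^sup>2 \<le> 1"
    by (simp add: power_mult_distrib)
  then show ?thesis using s1 by (simp add: D_def pos_le_divide_eq)
qed

text \<open>The part beyond \<open>d\<close> costs only a constant, by \<open>dirichlet_far\<close>.
  The lemma is applied in both directions between \<open>f\<close> and multiples of the pure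
  density.\<close>

lemma risk_dirichlet_le:
  assumes int: "set_integrable lborel {-pi..pi} f1" "set_integrable lborel {-pi..pi} f2"
    and nonneg: "\<And>x. x \<in> {-pi..pi} \<Longrightarrow> f1 x \<ge> 0" "\<And>x. x \<in> {-pi..pi} \<Longrightarrow> f2 x \<ge> 0"
    and d: "0 < d" and near: "\<And>x. \<bar>x\<bar> < d \<Longrightarrow> f1 x \<le> f2 x"
  obtains C where "\<And>n. risk f1 (dirichlet_poly n) \<le> risk f2 (dirichlet_poly n) + C"
proof
  fix n
  let ?D = "\<lambda>x. (cmod (poly (dirichlet_poly n) (cis x)))\<^sup>2"
  \<comment> \<open>The witness for \<open>C\<close> is \<open>K\<close> times the integral of
    \<open>f1\<close>; neither depends on \<open>n\<close>.\<close>
  define K where "K = 1 / (sin (d / 2))\<^sup>2"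
  have "risk f1 (dirichlet_poly n) \<le> (LINT x:{-pi..pi}|lborel. ?D x * f2 x + K * f1 x)"
    unfolding risk_def
  proof (rule set_integral_mono)
    fix x assume x: "x \<in> {-pi..pi}"
    show "?D x * f1 x \<le> ?D x * f2 x + K * f1 x"
    proof (cases "\<bar>x\<bar> < d")
      case True
      have "?D x * f1 x \<le> ?D x * f2 x" using near[OF True] by (intro mult_left_mono) auto
      moreover have "K * f1 x \<ge> 0" using nonneg(1)[OF x] by (simp add: K_def)
      ultimately show ?thesis by simp
    next
      case False
      have "?D x * f1 x \<le> K * f1 x"
        unfolding K_def using x False d nonneg(1)[OF x]
        by (intro mult_right_mono dirichlet_far) auto
      moreover have "?D x * f2 x \<ge> 0" using nonneg(2)[OF x] by simp
      ultimately show ?thesis by simp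
    qed
  qed (intro set_integral_add set_integrable_mult_right set_integrable_risk int)+
  also have "\<dots> = risk f2 (dirichlet_poly n) + K * (LINT x:{-pi..pi}|lborel. f1 x)"
    by (subst set_integral_add(2)) (auto simp: risk_def intro!: set_integrable_risk int)
  finally show "risk f1 (dirichlet_poly n) \<le> risk f2 (dirichlet_poly n) + K * (LINT x:{-pi..pi}|lborel. f1 x)" .
qed

lemma risk_mult: "risk (\<lambda>x. c * f0 x) P = c * risk f0 P"
proof -
  have "(cmod (poly P (cis x)))\<^sup>2 * (c * f0 x) = c * ((cmod (poly P (cis x)))\<^sup>2 * f0 x)" for x
    by simp
  then show ?thesis by (simp only: risk_def set_integral_mult_right)
qed

lemma Gamma_reflection_real: "Gamma (x :: real) * Gamma (1 - x) = pi / sin (pi * x)"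
proof -
  have eqs: "1 - complex_of_real x = of_real (1 - x)" "of_real pi * complex_of_real x = of_real (pi * x)"
    by simp_all
  have "complex_of_real (Gamma x * Gamma (1 - x)) = complex_of_real (pi / sin (pi * x))"
    using Gamma_reflection_complex[of "of_real x", unfolded eqs Gamma_complex_of_real sin_of_real]
    by (simp only: of_real_mult of_real_divide)
  then show ?thesis by (simp only: of_real_eq_iff)
qed

context comparable_density
begin

lemma g_gt_near_0:
  assumes "A < g 0"
  obtains d where "0 < d" "d < pi" "\<And>x. \<bar>x\<bar> < d \<Longrightarrow> A < g x"
proof -
  have "eventually (\<lambda>x. A < g x) (nhds 0)"
    using g_cont assms by (intro order_tendstoD(1)) (simp_all add: isCont_def tendsto_nhds_iff)
  then obtain d where d: "d > 0" "\<And>x. \<bar>x\<bar> < d \<Longrightarrow> A < g x"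
    by (auto simp: eventually_nhds_metric)
  show ?thesis by (rule that[of "min d 1"]) (use d pi_gt3 in auto)
qed

text \<open>By \<open>risk_dirichlet_le\<close> the risks agree up to a factor close to
  \<open>g 0\<close> and an additive constant, which vanishes relative to the divergent pure
  risk.\<close>

lemma risk_dirichlet_ratio:
  assumes top: "filterlim (\<lambda>n. risk (f_alpha a) (dirichlet_poly (Suc n))) at_top sequentially"
  shows "(\<lambda>n. risk f (dirichlet_poly (Suc n)) / risk (f_alpha a) (dirichlet_poly (Suc n))) \<longlonglongrightarrow> g 0"
proof -
  define V E where "V n = risk (f_alpha a) (dirichlet_poly (Suc n))"
    and "E n = risk f (dirichlet_poly (Suc n))" for n
  have V_pos: "eventually (\<lambda>n. V n > 0) sequentially"
    using top unfolding V_def filterlim_at_top_dense by blast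
  have C0: "(\<lambda>n. C / V n) \<longlonglongrightarrow> 0" for C
    using top unfolding V_def by (intro tendsto_divide_0[OF tendsto_const] filterlim_at_top_imp_at_infinity)
  have int: "set_integrable lborel {-pi..pi} (\<lambda>x. A * f_alpha a x)" for A
    by (intro set_integrable_mult_right set_integrable_f_alpha a_gt a_nz)
  have nonneg: "A * f_alpha a x \<ge> 0" if "A \<ge> 0" for A x
    using that f_alpha_nonneg[of a x] by simp
  have "(\<lambda>n. E n / V n) \<longlonglongrightarrow> g 0"
  proof (rule order_tendstoI)
    fix b assume "g 0 < b"
    then obtain A where A: "g 0 < A" "A < b" using dense by blast
    obtain d where d: "0 < d" "d < pi" "\<And>x. \<bar>x\<bar> < d \<Longrightarrow> g x < A"
      using g_lt_near_0[OF A(1)] by blast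
    have "\<And>x. \<bar>x\<bar> < d \<Longrightarrow> f x \<le> A * f_alpha a x"
      using d(3) f_alpha_nonneg[of a] by (metis less_imp_le mult.commute mult_left_mono)
    then obtain C where C: "\<And>n. risk f (dirichlet_poly n) \<le> A * risk (f_alpha a) (dirichlet_poly n) + C"
      using risk_dirichlet_le[OF f_int int[of A] f_nonneg nonneg[of A] d(1)] A g_0_pos
      unfolding risk_mult by auto
    have "(\<lambda>n. A + C / V n) \<longlonglongrightarrow> A + 0" by (intro tendsto_intros C0)
    then have "eventually (\<lambda>n. A + C / V n < b) sequentially"
      by (rule order_tendstoD(2)) (use A in simp)
    then show "eventually (\<lambda>n. E n / V n < b) sequentially"
      using V_pos
    proof eventually_elim
      case (elim n)
      have "E n / V n \<le> (A * V n + C) / V n"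
        using elim C[of "Suc n"] by (intro divide_right_mono) (auto simp: E_def V_def)
      then show ?case using elim by (simp add: add_divide_distrib)
    qed
  next
    fix b assume "b < g 0"
    \<comment> \<open>The maximum with 0 makes \<open>A\<close> positive, so that
      \<open>A * f_alpha a\<close> is a nonnegative density.\<close>
    then obtain A where "max b 0 < A" "A < g 0" using dense[of "max b 0" "g 0"] g_0_pos by auto
    then have A: "b < A" "0 < A" "A < g 0" by auto
    obtain d where d: "0 < d" "d < pi" "\<And>x. \<bar>x\<bar> < d \<Longrightarrow> A < g x"
      using g_gt_near_0[OF A(3)] by blast
    have "\<And>x. \<bar>x\<bar> < d \<Longrightarrow> A * f_alpha a x \<le> f x"
      using d(3) f_alpha_nonneg[of a] by (metis less_imp_le mult.commute mult_left_mono)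
    then obtain C where C: "\<And>n. A * risk (f_alpha a) (dirichlet_poly n) \<le> risk f (dirichlet_poly n) + C"
      using risk_dirichlet_le[OF int[of A] f_int nonneg[of A] f_nonneg d(1)] A
      unfolding risk_mult by auto
    have "(\<lambda>n. A - C / V n) \<longlonglongrightarrow> A - 0" by (intro tendsto_intros C0)
    then have "eventually (\<lambda>n. b < A - C / V n) sequentially"
      by (rule order_tendstoD(1)) (use A in simp)
    then show "eventually (\<lambda>n. b < E n / V n) sequentially"
      using V_pos
    proof eventually_elim
      case (elim n)
      have "(A * V n - C) / V n \<le> E n / V n"
        using elim C[of "Suc n"] by (intro divide_right_mono) (auto simp: E_def V_def)
      then show ?case using elim by (simp add: diff_divide_distrib)
    qed
  qed
  then show ?thesis by (simp add: E_def V_def)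
qed

lemma risk_dirichlet_bounded_below:
  obtains c where "c > 0" "eventually (\<lambda>n. risk f (dirichlet_poly (Suc n)) \<ge> c) sequentially"
proof -
  obtain d where d: "0 < d" "d < pi" "\<And>x. \<bar>x\<bar> < d \<Longrightarrow> g 0 / 2 < g x"
    using g_gt_near_0[of "g 0 / 2"] g_0_pos by auto
  define u w where "u = d / 4" and "w = d / 2"
  have uw: "0 < u" "u < w" "w < d" using d by (simp_all add: u_def w_def)
  have pos: "f_alpha a x > 0" if "x \<in> {u..w}" for x
  proof -
    have "sin (x / 2) > 0" using that uw d by (intro sin_gt_zero) auto
    then show ?thesis by (simp add: f_alpha_eq a_nz)
  qed
  have "continuous_on {u..w} (f_alpha a)"
    unfolding f_alpha_eq[OF a_nz, abs_def]
  proof (intro continuous_intros ballI)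
    fix x assume "x \<in> {u..w}"
    then have "sin (x / 2) > 0" using uw d by (intro sin_gt_zero) auto
    then show "\<bar>2 * sin (x / 2)\<bar> \<noteq> 0" by simp
  qed auto
  then obtain y where y: "y \<in> {u..w}" "\<And>x. x \<in> {u..w} \<Longrightarrow> f_alpha a y \<le> f_alpha a x"
    using continuous_attains_inf[of "{u..w}" "f_alpha a"] uw by auto
  \<comment> \<open>The divisor 4 comes from \<open>(2 * sin (x / 2))\<^sup>2 \<le> 4\<close>, the
    factor \<open>g 0 / 2\<close> from the choice of \<open>d\<close>.\<close>
  define k where "k = f_alpha a y * (g 0 / 2) / 4"
  have k: "k > 0" using pos[OF y(1)] g_0_pos by (simp add: k_def)
  have bound: "k * (2 * (w - u) - 4 / real n) \<le> risk f (dirichlet_poly n)" if n: "n > 0" for n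
  proof -
    let ?D = "\<lambda>x. (cmod (poly (dirichlet_poly n) (cis x)))\<^sup>2"
    define G where "G x = 2 * x - 2 * sin (real n * x) / real n" for x
    have hi: "((\<lambda>x. 2 - 2 * cos (real n * x)) has_integral (G w - G u)) {u..w}"
      unfolding G_def using uw n
      by (intro fundamental_theorem_of_calculus)
         (auto intro!: derivative_eq_intros simp flip: has_real_derivative_iff_has_vector_derivative)
    have si: "set_integrable lborel {u..w} (\<lambda>x. 2 - 2 * cos (real n * x))"
      by (intro borel_integrable_atLeastAtMost' continuous_intros)
    have "2 * (w - u) - 4 / real n \<le> G w - G u"
    proof -
      have "(sin (real n * w) - sin (real n * u)) / real n \<le> 2 / real n"
        using sin_le_one[of "real n * w"] sin_ge_minus_one[of "real n * u"]
        by (intro divide_right_mono) (linarith, simp)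
      then show ?thesis by (simp add: G_def diff_divide_distrib algebra_simps)
    qed
    also have "G w - G u = (LINT x:{u..w}|lborel. 2 - 2 * cos (real n * x))"
      using set_borel_integral_eq_integral(2)[OF si] hi by (simp add: integral_unique)
    finally have "k * (2 * (w - u) - 4 / real n) \<le> k * (LINT x:{u..w}|lborel. 2 - 2 * cos (real n * x))"
      using k by (intro mult_left_mono) auto
    also have "\<dots> = (LINT x:{u..w}|lborel. k * (2 - 2 * cos (real n * x)))"
      by simp
    also have "\<dots> \<le> risk f (dirichlet_poly n)"
      unfolding risk_def set_lebesgue_integral_def
    proof (rule integral_mono)
      show "integrable lborel (\<lambda>x. indicator {u..w} x *\<^sub>R (k * (2 - 2 * cos (real n * x))))"
        using set_integrable_mult_right[OF si, of k] by (simp add: set_integrable_def)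
      show "integrable lborel (\<lambda>x. indicator {-pi..pi} x *\<^sub>R (?D x * f x))"
        using set_integrable_risk[OF f_int] by (simp add: set_integrable_def)
      fix x
      show "indicator {u..w} x *\<^sub>R (k * (2 - 2 * cos (real n * x))) \<le> indicator {-pi..pi} x *\<^sub>R (?D x * f x)"
      proof (cases "x \<in> {u..w}")
        case False
        then show ?thesis using f_nonneg by (auto simp: indicator_def)
      next
        case True
        have x: "x \<in> {-pi..pi}" "\<bar>x\<bar> < d" using True uw d by auto
        have "?D x * (2 * sin (x / 2))\<^sup>2 \<le> ?D x * 4"
          by (intro mult_left_mono) (auto simp: power_mult_distrib abs_square_le_1)
        then have D: "2 - 2 * cos (real n * x) \<le> ?D x * 4"
          by (simp only: cmod_dirichlet_poly)
        have "f_alpha a y * (g 0 / 2) \<le> f x"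
          using y(2)[OF True] d(3)[OF x(2)] g_0_pos f_alpha_nonneg[of a] by (intro mult_mono) auto
        then have "f_alpha a y * (g 0 / 2) * (2 - 2 * cos (real n * x)) \<le> f x * (?D x * 4)"
          by (rule mult_mono[OF _ D]) (use f_nonneg[OF x(1)] in auto)
        then show ?thesis using True x by (simp add: k_def mult_ac)
      qed
    qed
    finally show ?thesis .
  qed
  have "(\<lambda>n. k * (2 * (w - u) - 4 / real (Suc n))) \<longlonglongrightarrow> k * (2 * (w - u) - 0)"
    by (intro tendsto_intros) real_asymp
  then have "eventually (\<lambda>n. k * (w - u) < k * (2 * (w - u) - 4 / real (Suc n))) sequentially"
    by (rule order_tendstoD(1)) (use k uw in simp)
  then have "eventually (\<lambda>n. k * (w - u) \<le> risk f (dirichlet_poly (Suc n))) sequentially"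
    by eventually_elim (use bound in \<open>meson less_imp_le order_trans zero_less_Suc\<close>)
  moreover have "k * (w - u) > 0" using k uw by simp
  ultimately show ?thesis using that by blast
qed

section \<open>Limits of the efficiency\<close>

text \<open>For \<open>Suc n\<close> observations the mean has variance
  \<open>risk / (Suc n)\<^sup>2\<close>. As \<open>var_blu_asymp\<close> settles the numerator, only
  the normalised reciprocal of the risk remains to be found.\<close>

lemma efficiency_tendsto:
  assumes "(\<lambda>n. real n powr (1 - 2 * a) / risk f (dirichlet_poly (Suc n))) \<longlonglongrightarrow> K"
  shows "efficiency f \<longlonglongrightarrow> g 0 * L * K"
proof -
  have "(\<lambda>n. (real n powr (1 + 2 * a) * var_blu f (Suc n)) * (real (Suc n) / real n)\<^sup>2
      * (real n powr (1 - 2 * a) / risk f (dirichlet_poly (Suc n)))) \<longlonglongrightarrow> (g 0 * L) * 1\<^sup>2 * K"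
    by (intro tendsto_intros assms var_blu_asymp) real_asymp
  moreover have "eventually (\<lambda>n. (real n powr (1 + 2 * a) * var_blu f (Suc n)) * (real (Suc n) / real n)\<^sup>2
      * (real n powr (1 - 2 * a) / risk f (dirichlet_poly (Suc n))) = efficiency f (Suc n)) sequentially"
    using eventually_gt_at_top[of 0]
  proof eventually_elim
    case (elim n)
    have "real n powr (1 + 2 * a) * real n powr (1 - 2 * a) = (real n)\<^sup>2"
      using elim by (simp add: powr_numeral flip: powr_add)
    moreover have "(p * b) * (s / y)\<^sup>2 * (q / e) = b / (e / s\<^sup>2)" if "p * q = y\<^sup>2" "y \<noteq> 0" for p q b s y e :: real
    proof -
      have "(p * b) * (s / y)\<^sup>2 * (q / e) = (p * q) * (b * (s / y)\<^sup>2 / e)" by simp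
      then show ?thesis using that by (simp add: power_divide)
    qed
    ultimately show ?case
      using elim by (simp only: efficiency_def var_mean_eq_risk of_nat_eq_0_iff less_numeral_extra)
  qed
  ultimately have "(\<lambda>n. efficiency f (Suc n)) \<longlonglongrightarrow> g 0 * L * 1\<^sup>2 * K"
    by (rule Lim_transform_eventually)
  then show ?thesis by (simp add: filterlim_sequentially_Suc)
qed

text \<open>Both variances carry \<open>acf a 0\<close> and \<open>g 0\<close>, which cancel and
  leave \<open>Gamma (2 * a + 2) / M\<close>; the reflection formula brings this into the stated
  form.\<close>

lemma efficiency_lt_half:
  assumes "a < 1/2"
  shows "efficiency f \<longlonglongrightarrow> pi * a * (1 - 2 * a) / (Beta (a + 1) (a + 1) * sin (pi * a))"
proof -
  define V where "V n = risk (f_alpha a) (dirichlet_poly (Suc n))" for n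
  define M where "M = Gamma (1 + a) / ((1 - 2 * a) * Gamma (1 - a))"
  have pos: "Gamma (1 + a) > 0" "Gamma (1 - a) > 0" "Gamma (2 * a + 2) > 0" "acf a 0 > 0"
    using assms a_gt a_nz by (auto intro!: Gamma_real_pos acf_0_pos)
  have M: "M > 0" using pos assms by (simp add: M_def)
  have lim: "(\<lambda>n. real n powr (2 * a - 1) * V n) \<longlonglongrightarrow> acf a 0 * M"
    unfolding V_def M_def by (intro risk_f_alpha_dirichlet_asymp a_gt a_nz assms)
  have top: "filterlim V at_top sequentially"
    unfolding V_def using assms by (intro risk_f_alpha_dirichlet_at_top a_gt a_nz) auto
  have ratio: "(\<lambda>n. risk f (dirichlet_poly (Suc n)) / V n) \<longlonglongrightarrow> g 0"
    using risk_dirichlet_ratio top unfolding V_def by blast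
  have "(\<lambda>n. 1 / ((real n powr (2 * a - 1) * V n) * (risk f (dirichlet_poly (Suc n)) / V n)))
      \<longlonglongrightarrow> 1 / ((acf a 0 * M) * g 0)"
    using pos M g_0_pos by (intro tendsto_intros lim ratio) auto
  moreover have "eventually (\<lambda>n. 1 / ((real n powr (2 * a - 1) * V n) * (risk f (dirichlet_poly (Suc n)) / V n))
      = real n powr (1 - 2 * a) / risk f (dirichlet_poly (Suc n))) sequentially"
    using top[unfolded filterlim_at_top_dense, rule_format, of 0] eventually_gt_at_top[of 0]
  proof eventually_elim
    case (elim n)
    have "real n powr (1 - 2 * a) = inverse (real n powr (2 * a - 1))"
      by (simp flip: powr_minus)
    then show ?case using elim by (simp add: divide_inverse)
  qed
  ultimately have "efficiency f \<longlonglongrightarrow> g 0 * L * (1 / ((acf a 0 * M) * g 0))"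
    by (intro efficiency_tendsto) (rule Lim_transform_eventually)
  moreover have "g 0 * L * (1 / ((acf a 0 * M) * g 0)) = Gamma (2 * a + 2) / M"
    using pos g_0_pos by (simp add: L_def)
  moreover have "Gamma (2 * a + 2) / M = pi * a * (1 - 2 * a) / (Beta (a + 1) (a + 1) * sin (pi * a))"
  proof -
    \<comment> \<open>The functional equation of Gamma is used at \<open>a\<close>, which must not
      be a pole.\<close>
    have "a \<notin> \<int>\<^sub>\<le>\<^sub>0"
    proof
      assume "a \<in> \<int>\<^sub>\<le>\<^sub>0"
      then obtain n where n: "a = - real n" by (rule nonpos_Ints_cases')
      then show False using a_gt a_nz by (cases n) auto
    qed
    then have "Gamma (1 + a) = a * Gamma a"
      using Gamma_plus1[of a] by (simp add: add.commute)
    then have "Gamma (1 + a) * Gamma (1 - a) = pi * a / sin (pi * a)"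
      using Gamma_reflection_real[of a] by (simp add: mult_ac)
    then have "pi * a * (1 - 2 * a) / (Beta (a + 1) (a + 1) * sin (pi * a))
        = (Gamma (1 + a) * Gamma (1 - a)) * ((1 - 2 * a) / Beta (a + 1) (a + 1))"
      by simp
    moreover have "Beta (a + 1) (a + 1) = Gamma (1 + a) * Gamma (1 + a) / Gamma (2 * a + 2)"
      by (simp add: Beta_def add.commute)
    ultimately show ?thesis
      using pos by (simp only:) (simp add: M_def)
  qed
  ultimately show ?thesis by simp
qed

text \<open>At \<open>a = 1/2\<close> the power of \<open>n\<close> is 1 and the risk diverges; for
  larger \<open>a\<close> the power tends to 0 and a positive lower bound for the risk
  suffices.\<close>

lemma efficiency_ge_half:
  assumes "a \<ge> 1/2"
  shows "efficiency f \<longlonglongrightarrow> 0"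
proof -
  have "(\<lambda>n. real n powr (1 - 2 * a) / risk f (dirichlet_poly (Suc n))) \<longlonglongrightarrow> 0"
  proof (cases "a = 1/2")
    case True
    have top: "filterlim (\<lambda>n. risk (f_alpha a) (dirichlet_poly (Suc n))) at_top sequentially"
      by (intro risk_f_alpha_dirichlet_at_top a_gt a_nz) (simp add: True)
    have "filterlim (\<lambda>n. risk f (dirichlet_poly (Suc n)) / risk (f_alpha a) (dirichlet_poly (Suc n))
        * risk (f_alpha a) (dirichlet_poly (Suc n))) at_top sequentially"
      by (rule filterlim_tendsto_pos_mult_at_top[OF risk_dirichlet_ratio[OF top] g_0_pos top])
    then have "filterlim (\<lambda>n. risk f (dirichlet_poly (Suc n))) at_top sequentially"
    proof (rule filterlim_mono_eventually)
      show "eventually (\<lambda>n. risk f (dirichlet_poly (Suc n)) / risk (f_alpha a) (dirichlet_poly (Suc n))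
        * risk (f_alpha a) (dirichlet_poly (Suc n)) = risk f (dirichlet_poly (Suc n))) sequentially"
        using top[unfolded filterlim_at_top_dense, rule_format, of 0] by eventually_elim simp
    qed auto
    then have "(\<lambda>n. 1 / risk f (dirichlet_poly (Suc n))) \<longlonglongrightarrow> 0"
      by (intro tendsto_divide_0[OF tendsto_const] filterlim_at_top_imp_at_infinity)
    moreover have "eventually (\<lambda>n. 1 / risk f (dirichlet_poly (Suc n))
        = real n powr (1 - 2 * a) / risk f (dirichlet_poly (Suc n))) sequentially"
      using eventually_gt_at_top[of 0] by eventually_elim (simp add: True)
    ultimately show ?thesis by (rule Lim_transform_eventually)
  next
    case False
    obtain c where c: "c > 0" "eventually (\<lambda>n. risk f (dirichlet_poly (Suc n)) \<ge> c) sequentially"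
      using risk_dirichlet_bounded_below by blast
    show ?thesis
    proof (rule tendsto_sandwich)
      show "eventually (\<lambda>n. real n powr (1 - 2 * a) / risk f (dirichlet_poly (Suc n)) \<le> real n powr (1 - 2 * a) / c) sequentially"
        using c(2) by eventually_elim (use c(1) in \<open>auto intro!: divide_left_mono mult_pos_pos\<close>)
      show "eventually (\<lambda>n. 0 \<le> real n powr (1 - 2 * a) / risk f (dirichlet_poly (Suc n))) sequentially"
        by (intro always_eventually allI divide_nonneg_nonneg risk_nonneg f_nonneg) auto
      show "(\<lambda>n. real n powr (1 - 2 * a) / c) \<longlonglongrightarrow> 0"
        using assms False c(1) by real_asymp
    qed simp
  qed
  from efficiency_tendsto[OF this] show ?thesis by simp
qed

end

section \<open>Densities with power zeros\<close>

lemma continuous_on_rpow0: "\<alpha> \<ge> 0 \<Longrightarrow> continuous_on A (\<lambda>x. rpow0 \<bar>x - l\<bar> \<alpha>)"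
  unfolding rpow0_def by (cases "\<alpha> = 0") (auto intro!: continuous_intros continuous_on_powr')

lemma rpow0_nonneg: "x \<ge> 0 \<Longrightarrow> rpow0 x \<alpha> \<ge> 0"
  by (simp add: rpow0_def)

lemma cmod_cis_diff_le: "cmod (cis x - cis y) \<le> \<bar>x - y\<bar>"
proof -
  have "cis x - cis y = cis y * (cis (x - y) - 1)"
    by (simp add: right_diff_distrib cis_mult)
  then have "cmod (cis x - cis y) = 2 * \<bar>sin ((x - y) / 2)\<bar>"
    using dist_exp_i_1[of "x - y"] by (simp add: norm_mult cis_conv_exp)
  then show ?thesis using abs_sin_x_le_abs_x[of "(x - y) / 2"] by simp
qed

text \<open>A polynomial that vanishes at \<open>cis l\<close> to high enough order to absorb the zero of the
  weight \<open>\<bar>x - l\<bar>\<^sup>\<alpha>\<close>; its value at 1 can be normalised because that zero is not at 0.\<close>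

lemma ex_poly_le_rpow0:
  assumes l: "l \<in> {-pi..pi}" and "\<alpha> \<ge> 0" and "\<alpha> = 0 \<or> l \<noteq> 0"
  shows "\<exists>T K. poly T 1 = 1 \<and> K > 0 \<and>
    (\<forall>x\<in>{-pi..pi}. (cmod (poly T (cis x)))\<^sup>2 \<le> K * rpow0 \<bar>x - l\<bar> \<alpha>)"
proof (cases "\<alpha> = 0")
  case True
  then show ?thesis by (intro exI[of _ 1]) (simp add: rpow0_def)
next
  case False
  with assms have al: "\<alpha> > 0" "l \<noteq> 0" by auto
  \<comment> \<open>With \<open>m \<ge> \<alpha>\<close> the exponent
    \<open>2 * m - \<alpha>\<close> is nonnegative, so the surplus power of
    \<open>y \<le> 2 * pi\<close> is bounded by a constant.\<close>
  define m where "m = nat \<lceil>\<alpha>\<rceil>"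
  have m: "real m \<ge> \<alpha>" "m > 0" using al by (auto simp: m_def)
  have nz: "cis l \<noteq> 1"
  proof
    assume "cis l = 1"
    then have "cos l = 1" by (simp add: complex_eq_iff)
    then have "sin (l / 2) = 0" using cos_double_sin[of "l / 2"] by simp
    moreover have "\<bar>l\<bar> \<le> pi" using l by auto
    ultimately show False using sin_half_nonzero[of l] al by simp
  qed
  define c where "c = 1 / (1 - cis l)"
  define T where "T = [:- cis l * c, c:] ^ m"
  have T: "poly T z = (c * (z - cis l)) ^ m" for z
    by (simp add: T_def poly_power algebra_simps)
  define K where "K = (cmod c ^ m)\<^sup>2 * (2 * pi) powr (2 * real m - \<alpha>)"
  have "poly T 1 = 1" using nz by (simp add: T c_def)
  moreover have "K > 0" using nz by (simp add: K_def c_def)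
  moreover have "(cmod (poly T (cis x)))\<^sup>2 \<le> K * rpow0 \<bar>x - l\<bar> \<alpha>" if x: "x \<in> {-pi..pi}" for x
  proof (cases "x = l")
    case True
    then show ?thesis using m al by (simp add: T rpow0_def)
  next
    case False
    define y where "y = \<bar>x - l\<bar>"
    have y: "0 < y" "y \<le> 2 * pi" using False x l by (auto simp: y_def)
    have "(cmod (poly T (cis x)))\<^sup>2 = (cmod c ^ m)\<^sup>2 * cmod (cis x - cis l) ^ (2 * m)"
      by (simp add: T norm_mult norm_power power_mult_distrib mult.commute flip: power_mult)
    also have "\<dots> \<le> (cmod c ^ m)\<^sup>2 * y ^ (2 * m)"
      unfolding y_def by (intro mult_left_mono power_mono cmod_cis_diff_le) auto
    also have "y ^ (2 * m) = y powr (2 * real m - \<alpha>) * y powr \<alpha>"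
      using y by (simp flip: powr_add powr_realpow)
    also have "(cmod c ^ m)\<^sup>2 * \<dots> \<le> (cmod c ^ m)\<^sup>2 * ((2 * pi) powr (2 * real m - \<alpha>) * y powr \<alpha>)"
      using y m al by (intro mult_left_mono mult_right_mono powr_mono2) auto
    also have "\<dots> = K * rpow0 \<bar>x - l\<bar> \<alpha>"
      using al by (simp add: K_def rpow0_def y_def)
    finally show ?thesis .
  qed
  ultimately show ?thesis by blast
qed

lemma ex_poly_le_prod_rpow0:
  fixes lam alph :: "nat \<Rightarrow> real"
  assumes "\<And>j. j < r \<Longrightarrow> lam j \<in> {-pi..pi}" "\<And>j. j < r \<Longrightarrow> alph j \<ge> 0"
    "\<And>j. j < r \<Longrightarrow> alph j = 0 \<or> lam j \<noteq> 0"
  shows "\<exists>T K. poly T 1 = 1 \<and> K > 0 \<and>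
    (\<forall>x\<in>{-pi..pi}. (cmod (poly T (cis x)))\<^sup>2 \<le> K * (\<Prod>j<r. rpow0 \<bar>x - lam j\<bar> (alph j)))"
  using assms
proof (induction r)
  case 0
  then show ?case by (intro exI[of _ 1]) simp
next
  case (Suc r)
  have "\<exists>T K. poly T 1 = 1 \<and> K > 0 \<and>
      (\<forall>x\<in>{-pi..pi}. (cmod (poly T (cis x)))\<^sup>2 \<le> K * (\<Prod>j<r. rpow0 \<bar>x - lam j\<bar> (alph j)))"
    using Suc.prems by (intro Suc.IH) auto
  then obtain T K where T: "poly T 1 = 1" "K > 0"
    "\<And>x. x \<in> {-pi..pi} \<Longrightarrow> (cmod (poly T (cis x)))\<^sup>2 \<le> K * (\<Prod>j<r. rpow0 \<bar>x - lam j\<bar> (alph j))"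
    by blast
  obtain S J where S: "poly S 1 = 1" "J > 0"
    "\<And>x. x \<in> {-pi..pi} \<Longrightarrow> (cmod (poly S (cis x)))\<^sup>2 \<le> J * rpow0 \<bar>x - lam r\<bar> (alph r)"
    using ex_poly_le_rpow0[of "lam r" "alph r"] Suc.prems by blast
  have "(cmod (poly (T * S) (cis x)))\<^sup>2 \<le> (K * J) * (\<Prod>j<Suc r. rpow0 \<bar>x - lam j\<bar> (alph j))"
    if x: "x \<in> {-pi..pi}" for x
  proof -
    have "(cmod (poly (T * S) (cis x)))\<^sup>2 = (cmod (poly T (cis x)))\<^sup>2 * (cmod (poly S (cis x)))\<^sup>2"
      by (simp add: norm_mult power_mult_distrib)
    also have "\<dots> \<le> (K * (\<Prod>j<r. rpow0 \<bar>x - lam j\<bar> (alph j))) * (J * rpow0 \<bar>x - lam r\<bar> (alph r))"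
      using T(2) by (intro mult_mono T(3) S(3) x mult_nonneg_nonneg prod_nonneg)
        (auto intro: rpow0_nonneg)
    finally show ?thesis by (simp add: mult_ac)
  qed
  moreover have "poly (T * S) 1 = 1" using T S by simp
  moreover have "K * J > 0" using T S by simp
  ultimately show ?case by blast
qed

text \<open>Near 0 the factor \<open>g\<close> is bounded and \<open>f_alpha a\<close> integrable;
  away from 0 \<open>f_alpha a\<close> is bounded by compactness, and \<open>h * w\<close> is
  integrable because \<open>w\<close> is bounded.\<close>

lemma set_integrable_f_alpha_mult:
  fixes g h :: "real \<Rightarrow> real"
  assumes "a > -1/2" "a \<noteq> 0" and cont: "isCont g 0"
    and h: "set_integrable lborel {-pi..pi} h"
    and w: "continuous_on {-pi..pi} w" and g: "\<And>x. x \<in> {-pi..pi} \<Longrightarrow> g x = h x * w x"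
  shows "set_integrable lborel {-pi..pi} (\<lambda>x. f_alpha a x * g x)"
proof -
  have "eventually (\<lambda>x. \<bar>g x\<bar> < \<bar>g 0\<bar> + 1) (nhds 0)"
    using cont by (intro order_tendstoD(2)[of _ "\<bar>g 0\<bar>"] tendsto_rabs) (simp_all add: isCont_def tendsto_nhds_iff)
  then obtain d where d: "d > 0" "\<And>x. \<bar>x\<bar> < d \<Longrightarrow> \<bar>g x\<bar> < \<bar>g 0\<bar> + 1"
    by (auto simp: eventually_nhds_metric)
  have "continuous_on ({-pi..pi} - {-d<..<d}) (f_alpha a)"
    unfolding f_alpha_eq[OF assms(2), abs_def]
  proof (intro continuous_intros ballI)
    fix x assume "x \<in> {-pi..pi} - {-d<..<d}"
    then have x: "x \<noteq> 0" "-pi \<le> x" "x \<le> pi" using d(1) by auto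
    have "sin (x / 2) \<noteq> 0"
      using x by (intro sin_half_nonzero) auto
    then show "\<bar>2 * sin (x / 2)\<bar> \<noteq> 0" by simp
  qed auto
  moreover have "compact ({-pi..pi} - {-d<..<d})" by (intro compact_diff) auto
  ultimately obtain M where M: "\<And>x. x \<in> {-pi..pi} - {-d<..<d} \<Longrightarrow> f_alpha a x \<le> M"
    using compact_continuous_image compact_imp_bounded bounded_real by (metis abs_le_D1 imageI)
  obtain W where W: "W > 0" "\<And>x. x \<in> {-pi..pi} \<Longrightarrow> \<bar>w x\<bar> \<le> W"
    using compact_imp_bounded[OF compact_continuous_image[OF w compact_Icc]]
    by (auto simp: bounded_pos)
  have "set_integrable lborel {-pi..pi} (\<lambda>x. (\<bar>g 0\<bar> + 1) * f_alpha a x + (\<bar>M\<bar> * W) * \<bar>h x\<bar>)"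
    by (intro set_integral_add set_integrable_mult_right set_integrable_f_alpha set_integrable_abs h assms(1,2))
  then show ?thesis
  proof (rule set_integrable_bound)
    have [measurable]: "(\<lambda>x. indicator {-pi..pi} x *\<^sub>R h x) \<in> borel_measurable lborel"
      using h unfolding set_integrable_def by blast
    have [measurable]: "(\<lambda>x. indicator {-pi..pi} x *\<^sub>R w x) \<in> borel_measurable lborel"
      using borel_integrable_atLeastAtMost'[OF w] unfolding set_integrable_def by blast
    \<comment> \<open>Measurability of \<open>h\<close> and \<open>w\<close> is known only on the
      interval, so each carries its own indicator.\<close>
    have "(\<lambda>x. f_alpha a x * ((indicator {-pi..pi} x *\<^sub>R h x) * (indicator {-pi..pi} x *\<^sub>R w x)))
        \<in> borel_measurable lborel"
      by measurable
    also have "(\<lambda>x. f_alpha a x * ((indicator {-pi..pi} x *\<^sub>R h x) * (indicator {-pi..pi} x *\<^sub>R w x)))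
        = (\<lambda>x. indicator {-pi..pi} x *\<^sub>R (f_alpha a x * g x))"
      by (auto simp: g indicator_def)
    finally show "set_borel_measurable lborel {-pi..pi} (\<lambda>x. f_alpha a x * g x)"
      by (simp add: set_borel_measurable_def)
    have "norm (f_alpha a x * g x) \<le> norm ((\<bar>g 0\<bar> + 1) * f_alpha a x + (\<bar>M\<bar> * W) * \<bar>h x\<bar>)"
      if x: "x \<in> {-pi..pi}" for x
    proof -
      have nn: "(\<bar>g 0\<bar> + 1) * f_alpha a x \<ge> 0" "(\<bar>M\<bar> * W) * \<bar>h x\<bar> \<ge> 0"
        using f_alpha_nonneg[of a x] W by auto
      have "f_alpha a x * \<bar>g x\<bar> \<le> (\<bar>g 0\<bar> + 1) * f_alpha a x + (\<bar>M\<bar> * W) * \<bar>h x\<bar>"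
      proof (cases "\<bar>x\<bar> < d")
        case True
        then have "f_alpha a x * \<bar>g x\<bar> \<le> f_alpha a x * (\<bar>g 0\<bar> + 1)"
          using d(2) by (intro mult_left_mono f_alpha_nonneg less_imp_le)
        then show ?thesis using nn by (simp add: mult.commute)
      next
        case False
        have "f_alpha a x * \<bar>g x\<bar> = f_alpha a x * \<bar>w x\<bar> * \<bar>h x\<bar>"
          by (simp add: g[OF x] abs_mult)
        also have "\<dots> \<le> \<bar>M\<bar> * W * \<bar>h x\<bar>"
        proof (intro mult_right_mono mult_mono)
          have "x \<in> {-pi..pi} - {-d<..<d}" using False x by auto
          then show "f_alpha a x \<le> \<bar>M\<bar>" using M[of x] by linarith
        qed (use W(2)[OF x] in auto)
        finally show ?thesis using nn by simp
      qed
      then show ?thesis using nn f_alpha_nonneg[of a x] by (simp add: abs_mult)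
    qed
    then show "AE x in lborel. x \<in> {-pi..pi} \<longrightarrow>
        norm (f_alpha a x * g x) \<le> norm ((\<bar>g 0\<bar> + 1) * f_alpha a x + (\<bar>M\<bar> * W) * \<bar>h x\<bar>)"
      by (intro AE_I2) blast
  qed
qed

section \<open>The density with power zeros as an instance of the comparison\<close>

theorem theorem6p2:
  fixes a :: real and g h :: "real \<Rightarrow> real" and r :: nat
    and lam alph :: "nat \<Rightarrow> real"
  assumes a_gt: "a > -1/2"
    and g_form: "\<And>x. x \<in> {-pi..pi} \<Longrightarrow> g x = h x * (\<Prod>j<r. rpow0 \<bar>x - lam j\<bar> (alph j))"
    and lam_in: "\<And>j. j < r \<Longrightarrow> lam j \<in> {-pi..pi}"
    and alph_nn: "\<And>j. j < r \<Longrightarrow> alph j \<ge> 0"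
    and h_nn: "\<And>x. x \<in> {-pi..pi} \<Longrightarrow> h x \<ge> 0"
    and h_int: "set_integrable lborel {-pi..pi} h"
    and h_cont: "isCont h 0"
    and h_lb: "\<exists>c>0. \<forall>x\<in>{-pi..pi}. h x \<ge> c"
    and g_sv: "slowly_varying_at_0 g"
    and g0: "g 0 > 0"
    and asym: "(\<lambda>k. cov (\<lambda>x. f_alpha a x * g x) k) \<sim>[sequentially]
               (\<lambda>k. cov (f_alpha a) k * of_real (g 0))"
  shows "(a \<in> {-1/2<..<1/2} \<and> a \<noteq> 0 \<longrightarrow>
            (efficiency (\<lambda>x. f_alpha a x * g x) \<longlonglongrightarrow>
               pi * a * (1 - 2 * a) / (Beta (a + 1) (a + 1) * sin (pi * a))))
       \<and> (a \<ge> 1/2 \<longrightarrow> (efficiency (\<lambda>x. f_alpha a x * g x) \<longlonglongrightarrow> 0))"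
proof (cases "a = 0")
  case True
  then show ?thesis by simp
next
  case False
  define w where "w x = (\<Prod>j<r. rpow0 \<bar>x - lam j\<bar> (alph j))" for x
  have w_cont: "continuous_on S w" for S
    unfolding w_def by (intro continuous_on_prod continuous_on_rpow0 alph_nn) simp
  have w_nonneg: "w x \<ge> 0" for x
    unfolding w_def by (intro prod_nonneg rpow0_nonneg) simp
  have g_eq: "g x = h x * w x" if "x \<in> {-pi..pi}" for x
    using g_form[OF that] by (simp add: w_def)
  have "isCont w 0" using w_cont[of UNIV] by (simp add: continuous_on_eq_continuous_at)
  then have "isCont (\<lambda>x. h x * w x) 0" by (intro continuous_mult h_cont)
  \<comment> \<open>The factorisation holds on a neighbourhood of 0, which transfers continuity at 0
    from \<open>h * w\<close> to \<open>g\<close>.\<close>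
  moreover have "eventually (\<lambda>x. h x * w x = g x) (nhds 0)"
    by (rule eventually_mono[OF eventually_nhds_in_open[of "{-pi<..<pi}"]]) (auto simp: g_eq)
  ultimately have g_cont: "isCont g 0"
    by (subst (asm) isCont_cong)
  \<comment> \<open>As \<open>g 0 > 0\<close>, no factor of the weight vanishes at 0; hence the
    compensating \<open>T\<close> can have value 1 at 1.\<close>
  have "w 0 \<noteq> 0" using g0 g_eq[of 0] by auto
  then have "alph j = 0 \<or> lam j \<noteq> 0" if "j < r" for j
    using that by (auto simp: w_def rpow0_def split: if_splits)
  then obtain T K where T: "poly T 1 = 1" "K > 0"
    "\<And>x. x \<in> {-pi..pi} \<Longrightarrow> (cmod (poly T (cis x)))\<^sup>2 \<le> K * w x"
    unfolding w_def using ex_poly_le_prod_rpow0[of r lam alph] lam_in alph_nn by blast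
  obtain c where c: "c > 0" "\<And>x. x \<in> {-pi..pi} \<Longrightarrow> h x \<ge> c" using h_lb by blast
  \<comment> \<open>From \<open>h \<ge> c\<close> follows \<open>c * w \<le> g\<close>, which turns
    the bound \<open>K * w\<close> into \<open>(K / c) * g\<close>.\<close>
  interpret comparable_density a g T "K / c"
  proof
    show "g x \<ge> 0" if "x \<in> {-pi..pi}" for x
      using that by (simp add: g_eq h_nn w_nonneg)
    show "set_integrable lborel {-pi..pi} (\<lambda>x. f_alpha a x * g x)"
      by (intro set_integrable_f_alpha_mult[OF a_gt False g_cont h_int w_cont] g_eq)
    show "(cmod (poly T (cis x)))\<^sup>2 \<le> K / c * g x" if x: "x \<in> {-pi..pi}" for x
    proof -
      have "c * w x \<le> g x" unfolding g_eq[OF x] by (intro mult_right_mono c(2) x w_nonneg)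
      then have "K / c * (c * w x) \<le> K / c * g x" using T(2) c(1) by (intro mult_left_mono) auto
      then show ?thesis using T(3)[OF x] c(1) by simp
    qed
  qed (use a_gt False g_cont g0 T(1) in auto)
  show ?thesis using efficiency_lt_half efficiency_ge_half by simp
qed

end
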